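(* Let $\langle\mathcal S,\mathcal A,\mathcal P,\mathcal R,\gamma\rangle$ be a discounted Markov decision process with $\gamma\in(0,1)$, let $\alpha>0$, $\epsilon>0$, and let $\pi$ be a stationary policy. Assume: (a) for each $s\in\mathcal S$, if $a\sim\pi(\cdot\mid s)$, then $\log\pi(a\mid s)$ is well defined almost surely; (b) $\sup_{(s,a)\in\mathcal S\times\mathcal A}\mathbb E_{r\sim R(s,a),\,(s',a')\sim\mathcal P^\pi(\cdot\mid s,a)}\bigl[|r-\gamma\alpha\log\pi(a'\mid s')|\bigr]<\infty$; (c) for every $F\in\mathcal X^{\mathrm{cdf}}$ and $x\in\mathbb R$, the map $(s,a)\mapsto\mathbb E_{r\sim R(s,a),\,(s',a')\sim\mathcal P^\pi(\cdot\mid s,a)}\bigl[F(s',a')\bigl(\tfrac{x-r}{\gamma}+\alpha\log\pi(a'\mid s')\bigr)\bigr]$ is measurable. Let $\mathcal T^\pi:=\mathbb V\,\mathcal T^\pi_{\mathrm{cdf}}\,\mathbb V^{-1}$ on $\mathcal X^{\mathrm{adm}}$. Then for every $F\in\mathcal X^{\mathrm{cdf}}$, $$\mathbb V(\mathcal T^\pi_{\mathrm{cdf}}F)=\mathcal T^\pi(\mathbb VF).$$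
   Context: MDP: $\mathcal S,\mathcal A$ are measurable spaces (states, actions), $\mathcal P(\cdot\mid s,a)$ is a transition kernel on $\mathcal S$, $\mathcal R:\mathcal S\times\mathcal A\times\mathcal S\to\mathbb R$ is a (measurable) reward function. A stationary policy $\pi$ assigns to each $s$ a probability distribution $\pi(\cdot\mid s)$ on $\mathcal A$; $\pi(a\mid s)$ denotes the value of its probability mass function / density. Sampling: $(s',a')\sim\mathcal P^\pi(\cdot\mid s,a)$ means $s'\sim\mathcal P(\cdot\mid s,a)$ and then $a'\sim\pi(\cdot\mid s')$; $r\sim R(s,a)$ denotes the one-step reward $r=\mathcal R(s,a,s')$ generated by the same next state $s'$. CDF domain: $\Gamma_F$ is the set of CDFs $F$ on $\mathbb R$ with $\int_{\mathbb R}(F(x)-\mathbf 1\{x\ge0\})^2dx<\infty$. $\mathcal X^{\mathrm{cdf}}$ is the set of all CDF fields $F:(s,a)\mapsto F(s,a)\in\Gamma_F$ (with $(s,a)\mapsto F(s,a)(x)$ measurable for each $x\in\mathbb R$) such that $\sup_{(s,a)}\int_{\mathbb R}(F(s,a)(x)-\mathbf 1\{x\ge0\})^2dx<\infty$. Operator: for $F\in\mathcal X^{\mathrm{cdf}}$, $(\mathcal T^\pi_{\mathrm{cdf}}F)(s,a)(x):=\mathbb E_{r\sim R(s,a),\,(s',a')\sim\mathcal P^\pi(\cdot\mid s,a)}\bigl[F(s',a')\bigl(\tfrac{x-r}{\gamma}+\alpha\log\pi(a'\mid s')\bigr)\bigr]$. Spectral transport: $\widehat f(\omega)=\frac1{\sqrt{2\pi}}\int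 f(x)e^{-i\omega x}dx$ is the unitary Fourier transform. For fixed $\epsilon>0$, $\mathcal H^{\mathrm{cdf}}_\epsilon=\{H:\int\frac{\omega^2}{\omega^2+\epsilon}|\widehat H(\omega)|^2d\omega<\infty\}$ and $\mathcal H_\epsilon=\{f:\|f\|^2_{\mathcal H_\epsilon}=\frac1{2\pi}\int\frac{|\widehat f(\omega)|^2}{\omega^2+\epsilon}d\omega<\infty\}$ (elements understood through their Fourier transforms). Centring: $C(F)=F-\mathbf 1\{\cdot\ge0\}$. $\mathcal U:\mathcal H^{\mathrm{cdf}}_\epsilon\to\mathcal H_\epsilon$ is defined by $\widehat{\mathcal UH}(\omega)=-\sqrt{2\pi}\,i\omega\,\overline{\widehat H(\omega)}$. $\mathcal V:=\mathcal U\circ C:\Gamma_F\to\mathcal H_\epsilon$, which is injective. For $F\in\mathcal X^{\mathrm{cdf}}$, $(\mathbb VF)(s,a):=\mathcal V(F(s,a))$. $\mathcal X^{\mathrm{adm}}:=\mathrm{range}(\mathbb V)$, so $\mathbb V:\mathcal X^{\mathrm{cdf}}\to\mathcal X^{\mathrm{adm}}$ is bijective with inverse given by pointwise $\mathcal V^{-1}$. *)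

theory Defs
  imports "HOL-Probability.Probability"
begin

section \<open>Markov decision processes and policies\<close>

text \<open>
  A measurable space is given by a measure of which only the carrier and the sigma-algebra matter.
  The reward is a function of \<open>(s, a, s')\<close>, so a one-step reward is determined by the next state.
\<close>

definition discounted_mdp ::
    "'s measure \<Rightarrow> 'a measure \<Rightarrow> ('s \<times> 'a \<Rightarrow> 's measure) \<Rightarrow> ('s \<times> 'a \<times> 's \<Rightarrow> real) \<Rightarrow> real \<Rightarrow> bool"
  where
  "discounted_mdp S A P R \<gamma> \<longleftrightarrow>
     P \<in> (S \<Otimes>\<^sub>M A) \<rightarrow>\<^sub>M prob_algebra S \<and>
     R \<in> borel_measurable (S \<Otimes>\<^sub>M A \<Otimes>\<^sub>M S) \<and>
     0 < \<gamma> \<and> \<gamma> < 1"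

text \<open>
  \<open>\<pi> s\<close> is the action distribution at \<open>s\<close>, and \<open>\<rho> (s, a)\<close> is the number written
  \<open>\<pi>(a | s)\<close>: the density of \<open>\<pi> s\<close> with respect to a reference measure \<open>\<mu>\<close> on the actions.
  Counting measure gives probability mass functions.  \<open>\<mu>\<close> need not be sigma-finite, so that
  mass functions on uncountable action spaces are covered.
\<close>

definition stationary_policy ::
    "'s measure \<Rightarrow> 'a measure \<Rightarrow> 'a measure \<Rightarrow> ('s \<Rightarrow> 'a measure) \<Rightarrow> ('s \<times> 'a \<Rightarrow> real) \<Rightarrow> bool"
  where
  "stationary_policy S A \<mu> \<pi> \<rho> \<longleftrightarrow>
     \<pi> \<in> S \<rightarrow>\<^sub>M prob_algebra A \<and>
     sets \<mu> = sets A \<and>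
     \<rho> \<in> borel_measurable (S \<Otimes>\<^sub>M A) \<and>
     (\<forall>s\<in>space S. (\<forall>a\<in>space A. 0 \<le> \<rho> (s, a)) \<and> \<pi> s = density \<mu> (\<lambda>a. ennreal (\<rho> (s, a))))"

definition next_pair ::
    "'s measure \<Rightarrow> 'a measure \<Rightarrow> ('s \<times> 'a \<Rightarrow> 's measure) \<Rightarrow> ('s \<Rightarrow> 'a measure) \<Rightarrow>
     's \<times> 'a \<Rightarrow> ('s \<times> 'a) measure"
  where
  "next_pair S A P \<pi> sa = P sa \<bind> (\<lambda>s'. \<pi> s' \<bind> (\<lambda>a'. return (S \<Otimes>\<^sub>M A) (s', a')))"


section \<open>CDF fields and the CDF Bellman operator\<close>

definition centre :: "(real \<Rightarrow> real) \<Rightarrow> real \<Rightarrow> real" where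
  "centre F x = F x - indicator {0..} x"

definition cramer_sq :: "(real \<Rightarrow> real) \<Rightarrow> ennreal" where
  "cramer_sq F = (\<integral>\<^sup>+ x. ennreal ((centre F x)\<^sup>2) \<partial>lborel)"

definition Gamma_F :: "(real \<Rightarrow> real) set" where
  "Gamma_F = {F. (\<exists>M. real_distribution M \<and> F = cdf M) \<and> cramer_sq F < \<infinity>}"

text \<open>Fields are extensional, i.e. they carry no information outside the state-action space.\<close>

definition X_cdf :: "'s measure \<Rightarrow> 'a measure \<Rightarrow> ('s \<times> 'a \<Rightarrow> real \<Rightarrow> real) set" where
  "X_cdf S A = {F \<in> space (S \<Otimes>\<^sub>M A) \<rightarrow>\<^sub>E Gamma_F.
     (\<forall>x. (\<lambda>sa. F sa x) \<in> borel_measurable (S \<Otimes>\<^sub>M A)) \<and>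
     (SUP sa\<in>space (S \<Otimes>\<^sub>M A). cramer_sq (F sa)) < \<infinity>}"

definition bellman_expectation ::
    "'s measure \<Rightarrow> 'a measure \<Rightarrow> ('s \<times> 'a \<Rightarrow> 's measure) \<Rightarrow> ('s \<times> 'a \<times> 's \<Rightarrow> real) \<Rightarrow> real \<Rightarrow> real \<Rightarrow>
     ('s \<Rightarrow> 'a measure) \<Rightarrow> ('s \<times> 'a \<Rightarrow> real) \<Rightarrow>
     ('s \<times> 'a \<Rightarrow> real \<Rightarrow> real) \<Rightarrow> 's \<times> 'a \<Rightarrow> real \<Rightarrow> real"
  where
  "bellman_expectation S A P R \<gamma> \<alpha> \<pi> \<rho> F = (\<lambda>(s, a) x.
     \<integral>(s', a'). F (s', a') ((x - R (s, a, s')) / \<gamma> + \<alpha> * ln (\<rho> (s', a'))) \<partial>next_pair S A P \<pi> (s, a))"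

definition T_cdf ::
    "'s measure \<Rightarrow> 'a measure \<Rightarrow> ('s \<times> 'a \<Rightarrow> 's measure) \<Rightarrow> ('s \<times> 'a \<times> 's \<Rightarrow> real) \<Rightarrow> real \<Rightarrow> real \<Rightarrow>
     ('s \<Rightarrow> 'a measure) \<Rightarrow> ('s \<times> 'a \<Rightarrow> real) \<Rightarrow>
     ('s \<times> 'a \<Rightarrow> real \<Rightarrow> real) \<Rightarrow> 's \<times> 'a \<Rightarrow> real \<Rightarrow> real"
  where
  "T_cdf S A P R \<gamma> \<alpha> \<pi> \<rho> F =
     (\<lambda>sa\<in>space (S \<Otimes>\<^sub>M A). bellman_expectation S A P R \<gamma> \<alpha> \<pi> \<rho> F sa)"


section \<open>Spectral transport\<close>

text \<open>
  The spaces \<open>H_cdf\<close> and \<open>H_eps\<close> consist of functions or distributions known through their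
  Fourier transforms.  An element is represented by its Fourier transform, which is a measurable
  function up to equality almost everywhere, i.e. by a set of functions of the frequency.
\<close>

definition ae_class :: "(real \<Rightarrow> complex) \<Rightarrow> (real \<Rightarrow> complex) set" where
  "ae_class g = {h \<in> borel_measurable borel. AE \<omega> in lborel. h \<omega> = g \<omega>}"

definition fourier_truncated :: "nat \<Rightarrow> (real \<Rightarrow> complex) \<Rightarrow> real \<Rightarrow> complex" where
  "fourier_truncated n f \<omega> =
     (1 / sqrt (2 * pi)) *\<^sub>R (LBINT x:{- real n..real n}. f x * iexp (- (\<omega> * x)))"

text \<open>
  The unitary Fourier transform of a square-integrable function, which need not be integrable: the
  limit in \<open>L\<^sup>2\<close> of the transforms of its truncations.  The limit is unique only
  almost everywhere, so the value is the set of all its versions.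
\<close>

definition fourier_L2 :: "(real \<Rightarrow> complex) \<Rightarrow> (real \<Rightarrow> complex) set" where
  "fourier_L2 f = {g \<in> borel_measurable borel.
     (\<integral>\<^sup>+ \<omega>. ennreal ((cmod (g \<omega>))\<^sup>2) \<partial>lborel) < \<infinity> \<and>
     (\<lambda>n. \<integral>\<^sup>+ \<omega>. ennreal ((cmod (fourier_truncated n f \<omega> - g \<omega>))\<^sup>2) \<partial>lborel)
       \<longlonglongrightarrow> 0}"

definition H_cdf :: "real \<Rightarrow> (real \<Rightarrow> complex) set set" where
  "H_cdf \<epsilon> = {ae_class g | g. g \<in> borel_measurable borel \<and>
     (\<integral>\<^sup>+ \<omega>. ennreal (\<omega>\<^sup>2 / (\<omega>\<^sup>2 + \<epsilon>) * (cmod (g \<omega>))\<^sup>2) \<partial>lborel) < \<infinity>}"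

definition H_eps :: "real \<Rightarrow> (real \<Rightarrow> complex) set set" where
  "H_eps \<epsilon> = {ae_class g | g. g \<in> borel_measurable borel \<and>
     ennreal (1 / (2 * pi)) * (\<integral>\<^sup>+ \<omega>. ennreal ((cmod (g \<omega>))\<^sup>2 / (\<omega>\<^sup>2 + \<epsilon>)) \<partial>lborel) < \<infinity>}"

definition U_op :: "real \<Rightarrow> (real \<Rightarrow> complex) set \<Rightarrow> (real \<Rightarrow> complex) set" where
  "U_op \<epsilon> = (\<lambda>H\<in>H_cdf \<epsilon>. \<Union>g\<in>H.
     ae_class (\<lambda>\<omega>. - (complex_of_real (sqrt (2 * pi)) * \<i> * complex_of_real \<omega> * cnj (g \<omega>))))"

definition V_op :: "real \<Rightarrow> (real \<Rightarrow> real) \<Rightarrow> (real \<Rightarrow> complex) set" where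
  "V_op \<epsilon> = (\<lambda>F\<in>Gamma_F. U_op \<epsilon> (fourier_L2 (\<lambda>x. complex_of_real (centre F x))))"

definition VV ::
    "'s measure \<Rightarrow> 'a measure \<Rightarrow> real \<Rightarrow>
     ('s \<times> 'a \<Rightarrow> real \<Rightarrow> real) \<Rightarrow> 's \<times> 'a \<Rightarrow> (real \<Rightarrow> complex) set"
  where
  "VV S A \<epsilon> = (\<lambda>F\<in>X_cdf S A. \<lambda>sa\<in>space (S \<Otimes>\<^sub>M A). V_op \<epsilon> (F sa))"

definition X_adm :: "'s measure \<Rightarrow> 'a measure \<Rightarrow> real \<Rightarrow> ('s \<times> 'a \<Rightarrow> (real \<Rightarrow> complex) set) set" where
  "X_adm S A \<epsilon> = VV S A \<epsilon> ` X_cdf S A"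

definition T_spec ::
    "'s measure \<Rightarrow> 'a measure \<Rightarrow> ('s \<times> 'a \<Rightarrow> 's measure) \<Rightarrow> ('s \<times> 'a \<times> 's \<Rightarrow> real) \<Rightarrow> real \<Rightarrow> real \<Rightarrow>
     ('s \<Rightarrow> 'a measure) \<Rightarrow> ('s \<times> 'a \<Rightarrow> real) \<Rightarrow> real \<Rightarrow>
     ('s \<times> 'a \<Rightarrow> (real \<Rightarrow> complex) set) \<Rightarrow> 's \<times> 'a \<Rightarrow> (real \<Rightarrow> complex) set"
  where
  "T_spec S A P R \<gamma> \<alpha> \<pi> \<rho> \<epsilon> =
     (\<lambda>\<Phi>\<in>X_adm S A \<epsilon>.
        VV S A \<epsilon> (T_cdf S A P R \<gamma> \<alpha> \<pi> \<rho> (the_inv_into (X_cdf S A) (VV S A \<epsilon>) \<Phi>)))"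

end

theory Submission
  imports Defs
begin

text \<open>
  By Fubini, the transform of the truncation of \<open>centre (cdf M)\<close> to \<open>[- n, n]\<close> is an explicit expression
  in the characteristic function of \<open>M\<close> clipped to \<open>[- n, n]\<close>, so these transforms converge
  pointwise.  Bessel's inequality for integrable functions (from a Gaussian summability kernel) and
  Fatou's lemma turn this into convergence in \<open>L\<^sup>2\<close>.  Hence \<open>V_op\<close> maps \<open>cdf M\<close> to
  the class of \<open>char M \<omega> - 1\<close>, and it is injective by Levy's uniqueness theorem.

  The CDF operator preserves \<open>X_cdf\<close>: it mixes the CDFs \<open>F (s', a')\<close>, scaled by \<open>\<gamma>\<close>
  and shifted by \<open>c = r - \<gamma> \<alpha> log \<pi>(a' | s')\<close>, so by Jensen and Tonelli the squared distance to the step function is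
  at most \<open>2 \<gamma> sup_F + 2 E \<bar>c\<bar>\<close>, where \<open>sup_F\<close> is the supremum of \<open>cramer_sq\<close> over the field.
\<close>

subsection \<open>Bessel's inequality for the Fourier transform\<close>

text \<open>This is the real part of the characteristic function of the standard normal law at
  \<open>z / \<sigma>\<close>, after the substitution x = \<sigma> \<omega>. That a probability
  density in z comes out is what makes the Gaussian weight a summability kernel.\<close>

lemma integral_gaussian_mult_cos:
  fixes \<sigma> z :: real
  assumes "0 < \<sigma>"
  shows "(\<integral>\<omega>. exp (- (\<sigma> * \<omega>)\<^sup>2 / 2) * cos (\<omega> * z) \<partial>lborel) = 2 * pi * normal_density 0 \<sigma> z"
proof -
  let ?t = "z / \<sigma>"
  have int: "integrable lborel (\<lambda>x. std_normal_density x *\<^sub>R iexp (?t * x))"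
    by (rule Bochner_Integration.integrable_bound[OF integrable_normal_density[of 1 0]]) auto
  have "complex_of_real (exp (- ?t\<^sup>2 / 2)) = (\<integral>x. iexp (?t * x) \<partial>density lborel std_normal_density)"
    using fun_cong[OF char_std_normal_distribution, of ?t] unfolding char_def by simp
  also have "\<dots> = (\<integral>x. std_normal_density x *\<^sub>R iexp (?t * x) \<partial>lborel)"
    by (subst integral_density) auto
  finally have "exp (- ?t\<^sup>2 / 2) = Re (\<integral>x. std_normal_density x *\<^sub>R iexp (?t * x) \<partial>lborel)"
    by (metis Re_complex_of_real)
  also have "\<dots> = (\<integral>x. Re (std_normal_density x *\<^sub>R iexp (?t * x)) \<partial>lborel)"
    using integral_Re[OF int] by simp
  also have "\<dots> = (\<integral>x. std_normal_density x * cos (?t * x) \<partial>lborel)"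
    by (simp add: Re_exp)
  also have "\<dots> = \<sigma> * (\<integral>\<omega>. std_normal_density (\<sigma> * \<omega>) * cos (?t * (\<sigma> * \<omega>)) \<partial>lborel)"
    by (subst lborel_integral_real_affine[where c = \<sigma> and t = 0]) (use assms in auto)
  also have "\<dots> = \<sigma> / sqrt (2 * pi) * (\<integral>\<omega>. exp (- (\<sigma> * \<omega>)\<^sup>2 / 2) * cos (\<omega> * z) \<partial>lborel)"
    using assms by (simp add: std_normal_density_def algebra_simps flip: integral_mult_right_zero)
  finally have *: "exp (- ?t\<^sup>2 / 2) = \<sigma> / sqrt (2 * pi) * (\<integral>\<omega>. exp (- (\<sigma> * \<omega>)\<^sup>2 / 2) * cos (\<omega> * z) \<partial>lborel)" .
  have "normal_density 0 \<sigma> z = exp (- ?t\<^sup>2 / 2) / (\<sigma> * sqrt (2 * pi))"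
    using assms by (simp add: normal_density_def real_sqrt_mult power_divide mult_ac)
  also have "\<dots> = (\<integral>\<omega>. exp (- (\<sigma> * \<omega>)\<^sup>2 / 2) * cos (\<omega> * z) \<partial>lborel) / (sqrt (2 * pi) * sqrt (2 * pi))"
    unfolding * using assms by simp
  finally show ?thesis by simp
qed

text \<open>Fatou's lemma, in the form in which an eventual bound passes to an almost everywhere
  limit. It serves to remove the Gaussian weight and, later, to send the larger of two truncations
  to infinity.\<close>

lemma nn_integral_le_of_tendsto:
  fixes u :: "nat \<Rightarrow> 'a \<Rightarrow> ennreal"
  assumes [measurable]: "\<And>n. u n \<in> borel_measurable M"
    and lim: "AE x in M. (\<lambda>n. u n x) \<longlonglongrightarrow> f x"
    and le: "eventually (\<lambda>n. (\<integral>\<^sup>+x. u n x \<partial>M) \<le> C) sequentially"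
  shows "(\<integral>\<^sup>+x. f x \<partial>M) \<le> C"
proof -
  have "(\<integral>\<^sup>+x. f x \<partial>M) = (\<integral>\<^sup>+x. liminf (\<lambda>n. u n x) \<partial>M)"
    using lim by (intro nn_integral_cong_AE) (auto simp: lim_imp_Liminf elim: eventually_mono)
  also have "\<dots> \<le> liminf (\<lambda>n. \<integral>\<^sup>+x. u n x \<partial>M)"
    by (rule nn_integral_liminf) simp
  also have "\<dots> \<le> liminf (\<lambda>n. C)"
    using le by (rule Liminf_mono)
  finally show ?thesis by (simp add: Liminf_const)
qed

lemma (in pair_sigma_finite) integrable_mult_pair:
  fixes f :: "'a \<Rightarrow> real" and g :: "'b \<Rightarrow> real"
  assumes [intro]: "integrable M1 f" "integrable M2 g"
  shows "integrable (M1 \<Otimes>\<^sub>M M2) (\<lambda>(x, y). f x * g y)"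
proof (rule Fubini_integrable)
  have [measurable]: "f \<in> borel_measurable M1" "g \<in> borel_measurable M2"
    using assms by auto
  show "(\<lambda>(x, y). f x * g y) \<in> borel_measurable (M1 \<Otimes>\<^sub>M M2)"
    by measurable
qed (auto simp: abs_mult)

text \<open>For fixed x the reflection of y to x - y turns the kernel into a normal density of total
  mass 1.\<close>

lemma nn_integral_normal_convolution:
  fixes h :: "real \<Rightarrow> ennreal"
  assumes [measurable]: "h \<in> borel_measurable borel" and "0 < \<sigma>"
  shows "(\<integral>\<^sup>+x. \<integral>\<^sup>+y. h x * ennreal (normal_density 0 \<sigma> (x - y)) \<partial>lborel \<partial>lborel) = (\<integral>\<^sup>+x. h x \<partial>lborel)"
proof -
  have "(\<integral>\<^sup>+y. ennreal (normal_density 0 \<sigma> (x - y)) \<partial>lborel) = 1" for x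
  proof -
    have "(\<integral>\<^sup>+y. ennreal (normal_density 0 \<sigma> (x - y)) \<partial>lborel) = (\<integral>\<^sup>+y. ennreal (normal_density 0 \<sigma> y) \<partial>lborel)"
      using nn_integral_real_affine[of "\<lambda>y. ennreal (normal_density 0 \<sigma> y)" "-1" x] by simp
    also have "\<dots> = 1"
      using assms by (subst nn_integral_eq_integral) auto
    finally show ?thesis .
  qed
  then show ?thesis by (simp add: nn_integral_cmult)
qed

text \<open>The squared modulus is the sum of the squares of the cosine and sine transforms, and
  cos(u - v) = cos u cos v + sin u sin v merges the two. The frequency now sits in a single cosine,
  ready to be integrated against a Gaussian.\<close>

lemma norm_fourier_sq_eq:
  fixes h :: "real \<Rightarrow> real"
  assumes h: "integrable lborel h"
  shows "(cmod (\<integral>x. h x *\<^sub>R iexp (- (\<omega> * x)) \<partial>lborel))\<^sup>2 =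
    (\<integral>(x, y). h x * h y * cos (\<omega> * (x - y)) \<partial>(lborel \<Otimes>\<^sub>M lborel))"
proof -
  have [measurable]: "h \<in> borel_measurable borel" using h by auto
  have i1: "integrable lborel (\<lambda>x. h x *\<^sub>R iexp (- (\<omega> * x)))"
    by (rule Bochner_Integration.integrable_bound[OF h]) auto
  have ic: "integrable lborel (\<lambda>x. h x * cos (\<omega> * x))" and iss: "integrable lborel (\<lambda>x. h x * sin (\<omega> * x))"
    by (rule Bochner_Integration.integrable_bound[OF h]; auto simp: abs_mult mult_left_le)+
  define a where "a = (\<integral>x. h x * cos (\<omega> * x) \<partial>lborel)"
  define b where "b = (\<integral>x. h x * sin (\<omega> * x) \<partial>lborel)"
  have re: "Re (\<integral>x. h x *\<^sub>R iexp (- (\<omega> * x)) \<partial>lborel) = a"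
    unfolding a_def by (subst integral_Re[OF i1, symmetric]) (simp add: Re_exp)
  have im: "Im (\<integral>x. h x *\<^sub>R iexp (- (\<omega> * x)) \<partial>lborel) = - b"
    unfolding b_def by (subst integral_Im[OF i1, symmetric]) (simp add: Im_exp)
  have "(\<integral>(x, y). h x * h y * cos (\<omega> * (x - y)) \<partial>(lborel \<Otimes>\<^sub>M lborel)) =
      (\<integral>x. \<integral>y. h x * h y * cos (\<omega> * (x - y)) \<partial>lborel \<partial>lborel)"
    by (rule lborel_pair.integral_fst[symmetric],
        rule Bochner_Integration.integrable_bound[OF lborel_pair.integrable_mult_pair[OF h h]])
      (auto simp: abs_mult mult_left_le)
  also have "\<dots> = (\<integral>x. h x * cos (\<omega> * x) * a + h x * sin (\<omega> * x) * b \<partial>lborel)"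
  proof (rule Bochner_Integration.integral_cong[OF refl])
    fix x
    have "(\<integral>y. h x * h y * cos (\<omega> * (x - y)) \<partial>lborel) =
       (\<integral>y. h x * cos (\<omega> * x) * (h y * cos (\<omega> * y)) + h x * sin (\<omega> * x) * (h y * sin (\<omega> * y)) \<partial>lborel)"
      by (rule Bochner_Integration.integral_cong[OF refl]) (simp add: right_diff_distrib cos_diff algebra_simps)
    also have "\<dots> = h x * cos (\<omega> * x) * a + h x * sin (\<omega> * x) * b"
      using ic iss by (simp add: a_def b_def)
    finally show "(\<integral>y. h x * h y * cos (\<omega> * (x - y)) \<partial>lborel) = h x * cos (\<omega> * x) * a + h x * sin (\<omega> * x) * b" .
  qed
  also have "\<dots> = a\<^sup>2 + b\<^sup>2"
    using ic iss by (simp add: a_def b_def power2_eq_square)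
  finally show ?thesis unfolding cmod_power2 re im by simp
qed

text \<open>The weight makes everything absolutely integrable, so Fubini lets the frequency be
  integrated first, which leaves h(x) h(y) times 2 pi times a normal density in x - y. Bounding the
  product by squares then lets the other variable integrate out.\<close>

lemma nn_integral_fourier_gaussian_le:
  fixes h :: "real \<Rightarrow> real"
  assumes h: "integrable lborel h" and \<sigma>: "0 < \<sigma>"
  shows "(\<integral>\<^sup>+\<omega>. ennreal (exp (- (\<sigma> * \<omega>)\<^sup>2 / 2) * (cmod (\<integral>x. h x *\<^sub>R iexp (- (\<omega> * x)) \<partial>lborel))\<^sup>2) \<partial>lborel)
    \<le> ennreal (2 * pi) * (\<integral>\<^sup>+x. ennreal ((h x)\<^sup>2) \<partial>lborel)"
proof -
  have [measurable]: "h \<in> borel_measurable borel" using h by auto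
  let ?Q = "lborel \<Otimes>\<^sub>M lborel :: (real \<times> real) measure"
  interpret Q: pair_sigma_finite lborel ?Q by standard
  let ?w = "\<lambda>\<omega>. exp (- (\<sigma> * \<omega>)\<^sup>2 / 2)"
  let ?g = "\<lambda>p. h (fst p) * h (snd p)"
  let ?f = "\<lambda>\<omega> p. ?w \<omega> * (?g p * cos (\<omega> * (fst p - snd p)))"
  let ?nd = "normal_density 0 \<sigma>"
  have w: "integrable lborel ?w"
  proof -
    have "?w = (\<lambda>\<omega>. sqrt (2 * pi * (1 / \<sigma>)\<^sup>2) * normal_density 0 (1 / \<sigma>) \<omega>)"
      using \<sigma> by (auto simp: normal_density_def fun_eq_iff power_mult_distrib field_simps)
    then show ?thesis using \<sigma> by simp
  qed
  have g: "integrable ?Q ?g"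
    using lborel_pair.integrable_mult_pair[OF h h] by (simp add: case_prod_beta')
  have f: "integrable (lborel \<Otimes>\<^sub>M ?Q) (\<lambda>(\<omega>, p). ?f \<omega> p)"
    by (rule Bochner_Integration.integrable_bound[OF Q.integrable_mult_pair[OF w g]])
      (auto simp: abs_mult intro!: AE_I2 mult_left_mono mult_left_le)
  have eq: "?w \<omega> * (cmod (\<integral>x. h x *\<^sub>R iexp (- (\<omega> * x)) \<partial>lborel))\<^sup>2 = (\<integral>p. ?f \<omega> p \<partial>?Q)" for \<omega>
    unfolding norm_fourier_sq_eq[OF h] by (simp add: case_prod_beta')
  have "(\<integral>\<^sup>+\<omega>. ennreal (?w \<omega> * (cmod (\<integral>x. h x *\<^sub>R iexp (- (\<omega> * x)) \<partial>lborel))\<^sup>2) \<partial>lborel)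
      = ennreal (\<integral>\<omega>. \<integral>p. ?f \<omega> p \<partial>?Q \<partial>lborel)"
    unfolding eq
    by (rule nn_integral_eq_integral[OF Q.integrable_fst[OF f]], rule AE_I2, subst eq[symmetric]) simp
  also have "(\<integral>\<omega>. \<integral>p. ?f \<omega> p \<partial>?Q \<partial>lborel) = (\<integral>p. \<integral>\<omega>. ?f \<omega> p \<partial>lborel \<partial>?Q)"
    using Q.Fubini_integral[OF f] by simp
  also have "\<dots> = (\<integral>p. 2 * pi * ?g p * ?nd (fst p - snd p) \<partial>?Q)"
  proof (rule Bochner_Integration.integral_cong[OF refl])
    fix p :: "real \<times> real"
    have "(\<integral>\<omega>. ?f \<omega> p \<partial>lborel) = (\<integral>\<omega>. ?g p * (?w \<omega> * cos (\<omega> * (fst p - snd p))) \<partial>lborel)"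
      by (rule Bochner_Integration.integral_cong[OF refl]) (simp add: algebra_simps)
    also have "\<dots> = ?g p * (\<integral>\<omega>. ?w \<omega> * cos (\<omega> * (fst p - snd p)) \<partial>lborel)"
      by (rule integral_mult_right_zero)
    also have "\<dots> = 2 * pi * ?g p * ?nd (fst p - snd p)"
      by (subst integral_gaussian_mult_cos[OF \<sigma>]) simp
    finally show "(\<integral>\<omega>. ?f \<omega> p \<partial>lborel) = 2 * pi * ?g p * ?nd (fst p - snd p)" .
  qed
  also have "ennreal \<dots> \<le> ennreal (norm \<dots>)"
    by (rule ennreal_leI) simp
  \<comment> \<open>A non-integrable integrand has Bochner integral 0 by convention, which makes the
    bound trivial in that case.\<close>
  also have "\<dots> \<le> (\<integral>\<^sup>+p. norm (2 * pi * ?g p * ?nd (fst p - snd p)) \<partial>?Q)"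
  proof (cases "integrable ?Q (\<lambda>p. 2 * pi * ?g p * ?nd (fst p - snd p))")
    case True
    then show ?thesis by (rule integral_norm_bound_ennreal)
  qed (simp add: not_integrable_integral_eq)
  also have "\<dots> \<le> (\<integral>\<^sup>+p. ennreal pi * (ennreal ((h (fst p))\<^sup>2) * ennreal (?nd (fst p - snd p)))
       + ennreal pi * (ennreal ((h (snd p))\<^sup>2) * ennreal (?nd (snd p - fst p))) \<partial>?Q)"
  proof (rule nn_integral_mono)
    fix p :: "real \<times> real"
    \<comment> \<open>The arithmetic-geometric mean inequality: each resulting term depends on
      \<open>h\<close> in one variable only, and the kernel is symmetric.\<close>
    have "2 * \<bar>?g p\<bar> \<le> (h (fst p))\<^sup>2 + (h (snd p))\<^sup>2"
      using sum_squares_bound[of "\<bar>h (fst p)\<bar>" "\<bar>h (snd p)\<bar>"] by (simp add: abs_mult)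
    then have "2 * \<bar>?g p\<bar> * (pi * ?nd (fst p - snd p)) \<le> ((h (fst p))\<^sup>2 + (h (snd p))\<^sup>2) * (pi * ?nd (fst p - snd p))"
      by (rule mult_right_mono) simp
    moreover have "?nd (snd p - fst p) = ?nd (fst p - snd p)"
      by (simp add: normal_density_def power2_commute)
    ultimately show "ennreal (norm (2 * pi * ?g p * ?nd (fst p - snd p))) \<le>
       ennreal pi * (ennreal ((h (fst p))\<^sup>2) * ennreal (?nd (fst p - snd p)))
       + ennreal pi * (ennreal ((h (snd p))\<^sup>2) * ennreal (?nd (snd p - fst p)))"
      by (simp add: abs_mult algebra_simps flip: ennreal_mult' ennreal_plus)
  qed
  also have "\<dots> = ennreal pi * (\<integral>\<^sup>+p. ennreal ((h (fst p))\<^sup>2) * ennreal (?nd (fst p - snd p)) \<partial>?Q)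
      + ennreal pi * (\<integral>\<^sup>+p. ennreal ((h (snd p))\<^sup>2) * ennreal (?nd (snd p - fst p)) \<partial>?Q)"
    by (simp add: nn_integral_add nn_integral_cmult)
  also have "(\<integral>\<^sup>+p. ennreal ((h (fst p))\<^sup>2) * ennreal (?nd (fst p - snd p)) \<partial>?Q) = (\<integral>\<^sup>+x. ennreal ((h x)\<^sup>2) \<partial>lborel)"
    using nn_integral_normal_convolution[of "\<lambda>x. ennreal ((h x)\<^sup>2)", OF _ \<sigma>]
    by (subst lborel.nn_integral_fst[symmetric]) auto
  also have "(\<integral>\<^sup>+p. ennreal ((h (snd p))\<^sup>2) * ennreal (?nd (snd p - fst p)) \<partial>?Q) = (\<integral>\<^sup>+x. ennreal ((h x)\<^sup>2) \<partial>lborel)"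
    using nn_integral_normal_convolution[of "\<lambda>x. ennreal ((h x)\<^sup>2)", OF _ \<sigma>]
    by (subst lborel_pair.nn_integral_snd[symmetric]) auto
  finally show ?thesis
    by (simp add: distrib_right[symmetric] flip: ennreal_plus)
qed

text \<open>The Gaussian bound does not depend on the width, so the weight can be sent to 1 along
  \<sigma> = 1/(n+1). The factor 2 pi reflects the missing normalisation of the transform.\<close>

lemma nn_integral_fourier_le:
  fixes h :: "real \<Rightarrow> real"
  assumes h: "integrable lborel h"
  shows "(\<integral>\<^sup>+\<omega>. ennreal ((cmod (\<integral>x. h x *\<^sub>R iexp (- (\<omega> * x)) \<partial>lborel))\<^sup>2) \<partial>lborel)
    \<le> ennreal (2 * pi) * (\<integral>\<^sup>+x. ennreal ((h x)\<^sup>2) \<partial>lborel)"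
proof (rule nn_integral_le_of_tendsto)
  have [measurable]: "h \<in> borel_measurable borel" using h by auto
  let ?\<sigma> = "\<lambda>n. 1 / real (Suc n)"
  let ?u = "\<lambda>n \<omega>. ennreal (exp (- (?\<sigma> n * \<omega>)\<^sup>2 / 2) * (cmod (\<integral>x. h x *\<^sub>R iexp (- (\<omega> * x)) \<partial>lborel))\<^sup>2)"
  show "?u n \<in> borel_measurable lborel" for n by measurable
  \<comment> \<open>The limit is written with 0 substituted for \<sigma>, the shape that the limit
    rules produce; its exponential factor is 1.\<close>
  have "(\<lambda>n. exp (- (?\<sigma> n * \<omega>)\<^sup>2 / 2) * c) \<longlonglongrightarrow> exp (- (0 * \<omega>)\<^sup>2 / 2) * c" for \<omega> c :: real
    by (intro tendsto_intros LIMSEQ_Suc[OF lim_1_over_n])  simp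
  then show "AE \<omega> in lborel. (\<lambda>n. ?u n \<omega>) \<longlonglongrightarrow> ennreal ((cmod (\<integral>x. h x *\<^sub>R iexp (- (\<omega> * x)) \<partial>lborel))\<^sup>2)"
    by (intro AE_I2 tendsto_ennrealI) simp
  show "eventually (\<lambda>n. (\<integral>\<^sup>+\<omega>. ?u n \<omega> \<partial>lborel) \<le> ennreal (2 * pi) * (\<integral>\<^sup>+x. ennreal ((h x)\<^sup>2) \<partial>lborel)) sequentially"
    by (intro always_eventually allI nn_integral_fourier_gaussian_le[OF h]) simp
qed

subsection \<open>Square-integrable functions\<close>

text \<open>This takes the place of Minkowski's inequality while staying with squares. It is the
  source of the factors 2 in the later bounds on \<open>cramer_sq\<close>.\<close>

lemma nn_integral_norm_add_sq_le:
  fixes f g :: "'a \<Rightarrow> 'b::{real_normed_vector,second_countable_topology}"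
  assumes [measurable]: "f \<in> borel_measurable M" "g \<in> borel_measurable M"
  shows "(\<integral>\<^sup>+x. ennreal ((norm (f x + g x))\<^sup>2) \<partial>M) \<le>
    2 * (\<integral>\<^sup>+x. ennreal ((norm (f x))\<^sup>2) \<partial>M) + 2 * (\<integral>\<^sup>+x. ennreal ((norm (g x))\<^sup>2) \<partial>M)"
proof -
  have "(\<integral>\<^sup>+x. ennreal ((norm (f x + g x))\<^sup>2) \<partial>M) \<le>
    (\<integral>\<^sup>+x. 2 * ennreal ((norm (f x))\<^sup>2) + 2 * ennreal ((norm (g x))\<^sup>2) \<partial>M)"
  proof (rule nn_integral_mono)
    fix x
    have "(norm (f x + g x))\<^sup>2 \<le> (norm (f x) + norm (g x))\<^sup>2"
      by (intro power_mono norm_triangle_ineq) simp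
    also have "\<dots> \<le> 2 * (norm (f x))\<^sup>2 + 2 * (norm (g x))\<^sup>2"
      using sum_squares_bound[of "norm (f x)" "norm (g x)"] by (simp add: power2_sum)
    finally have "ennreal ((norm (f x + g x))\<^sup>2) \<le> ennreal (2 * (norm (f x))\<^sup>2 + 2 * (norm (g x))\<^sup>2)"
      by (rule ennreal_leI)
    then show "ennreal ((norm (f x + g x))\<^sup>2) \<le> 2 * ennreal ((norm (f x))\<^sup>2) + 2 * ennreal ((norm (g x))\<^sup>2)"
      by (simp add: ennreal_mult)
  qed
  also have "\<dots> = 2 * (\<integral>\<^sup>+x. ennreal ((norm (f x))\<^sup>2) \<partial>M) + 2 * (\<integral>\<^sup>+x. ennreal ((norm (g x))\<^sup>2) \<partial>M)"
    by (simp add: nn_integral_add nn_integral_cmult)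
  finally show ?thesis .
qed

section \<open>Truncated Fourier transforms and their limits in L2\<close>

lemma borel_measurable_fourier_truncated [measurable]:
  assumes [measurable]: "f \<in> borel_measurable borel"
  shows "fourier_truncated n f \<in> borel_measurable borel"
  unfolding fourier_truncated_def[abs_def] set_lebesgue_integral_def by measurable

text \<open>On a bounded interval 1 + y^2 is an integrable majorant of |y|. Bessel's inequality
  thereby becomes applicable to truncations.\<close>

lemma integrable_truncated_L2:
  fixes \<phi> :: "real \<Rightarrow> real"
  assumes [measurable]: "\<phi> \<in> borel_measurable borel"
    and L2: "(\<integral>\<^sup>+x. ennreal ((\<phi> x)\<^sup>2) \<partial>lborel) < \<infinity>"
  shows "integrable lborel (\<lambda>x. indicator {- real n..real n} x * \<phi> x)"
proof (rule Bochner_Integration.integrable_bound)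
  have "integrable lborel (\<lambda>x. (\<phi> x)\<^sup>2)"
    using L2 by (intro integrableI_bounded) auto
  then show "integrable lborel (\<lambda>x. indicator {- real n..real n} x + (\<phi> x)\<^sup>2)"
    by (intro Bochner_Integration.integrable_add) auto
  have "\<bar>y\<bar> \<le> 1 + y\<^sup>2" for y :: real
    using sum_squares_bound[of "\<bar>y\<bar>" 1] zero_le_power2[of y] abs_ge_zero[of y] by (simp del: zero_le_power2 abs_ge_zero)
  then show "AE x in lborel. norm (indicator {- real n..real n} x * \<phi> x) \<le> norm (indicator {- real n..real n} x + (\<phi> x)\<^sup>2)"
    by (auto simp: indicator_def)
qed simp

lemma fourier_truncated_of_real:
  "fourier_truncated n (\<lambda>x. complex_of_real (\<phi> x)) \<omega> =
    (1 / sqrt (2 * pi)) *\<^sub>R (\<integral>x. (indicator {- real n..real n} x * \<phi> x) *\<^sub>R iexp (- (\<omega> * x)) \<partial>lborel)"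
  by (simp add: fourier_truncated_def set_lebesgue_integral_def scaleR_conv_of_real mult.assoc)

text \<open>The difference is the transform of \<phi> restricted to the points of [-m, m] outside
  [-n, n]. The unitary factor 1/(2 pi) cancels the constant in Bessel's inequality, and enlarging
  the region gives a bound free of m.\<close>

lemma fourier_truncated_diff_le:
  fixes \<phi> :: "real \<Rightarrow> real"
  assumes [measurable]: "\<phi> \<in> borel_measurable borel"
    and L2: "(\<integral>\<^sup>+x. ennreal ((\<phi> x)\<^sup>2) \<partial>lborel) < \<infinity>"
    and "n \<le> m"
  shows "(\<integral>\<^sup>+\<omega>. ennreal ((cmod (fourier_truncated n (\<lambda>x. complex_of_real (\<phi> x)) \<omega> - fourier_truncated m (\<lambda>x. complex_of_real (\<phi> x)) \<omega>))\<^sup>2) \<partial>lborel)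
    \<le> (\<integral>\<^sup>+x. ennreal ((indicator (- {- real n..real n}) x * \<phi> x)\<^sup>2) \<partial>lborel)"
proof -
  let ?i = "\<lambda>n x. indicator {- real n..real n} x * \<phi> x"
  let ?h = "\<lambda>x. ?i n x - ?i m x"
  note i = integrable_truncated_L2[OF assms(1) L2]
  have i': "integrable lborel (\<lambda>x. ?i n x *\<^sub>R iexp (- (\<omega> * x)))" for n \<omega>
    by (rule Bochner_Integration.integrable_bound[OF i[of n]]) auto
  have "(cmod (fourier_truncated n (\<lambda>x. complex_of_real (\<phi> x)) \<omega> - fourier_truncated m (\<lambda>x. complex_of_real (\<phi> x)) \<omega>))\<^sup>2
      = 1 / (2 * pi) * (cmod (\<integral>x. ?h x *\<^sub>R iexp (- (\<omega> * x)) \<partial>lborel))\<^sup>2" for \<omega>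
  proof -
    have "fourier_truncated n (\<lambda>x. complex_of_real (\<phi> x)) \<omega> - fourier_truncated m (\<lambda>x. complex_of_real (\<phi> x)) \<omega>
      = (1 / sqrt (2 * pi)) *\<^sub>R (\<integral>x. ?h x *\<^sub>R iexp (- (\<omega> * x)) \<partial>lborel)"
      unfolding fourier_truncated_of_real scaleR_right_diff_distrib[symmetric] scaleR_left_diff_distrib
      by (subst Bochner_Integration.integral_diff[OF i' i']) simp
    then show ?thesis
      by (simp add: power_mult_distrib power_divide)
  qed
  then have "(\<integral>\<^sup>+\<omega>. ennreal ((cmod (fourier_truncated n (\<lambda>x. complex_of_real (\<phi> x)) \<omega> - fourier_truncated m (\<lambda>x. complex_of_real (\<phi> x)) \<omega>))\<^sup>2) \<partial>lborel)
    = ennreal (1 / (2 * pi)) * (\<integral>\<^sup>+\<omega>. ennreal ((cmod (\<integral>x. ?h x *\<^sub>R iexp (- (\<omega> * x)) \<partial>lborel))\<^sup>2) \<partial>lborel)"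
    by (simp add: ennreal_mult' nn_integral_cmult del: times_divide_eq_left)
  also have "\<dots> \<le> ennreal (1 / (2 * pi)) * (ennreal (2 * pi) * (\<integral>\<^sup>+x. ennreal ((?h x)\<^sup>2) \<partial>lborel))"
    by (intro mult_left_mono nn_integral_fourier_le Bochner_Integration.integrable_diff i) simp
  also have "\<dots> = (\<integral>\<^sup>+x. ennreal ((?h x)\<^sup>2) \<partial>lborel)"
    by (simp add: mult.assoc[symmetric] flip: ennreal_mult)
  also have "\<dots> \<le> (\<integral>\<^sup>+x. ennreal ((indicator (- {- real n..real n}) x * \<phi> x)\<^sup>2) \<partial>lborel)"
    using \<open>n \<le> m\<close> by (intro nn_integral_mono ennreal_leI) (auto simp: indicator_def)
  finally show ?thesis .
qed

text \<open>The bound on differences is uniform in the larger truncation m, so Fatou's lemma as m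
  grows carries it over to the pointwise limit \<open>g\<close>.\<close>

lemma fourier_truncated_tendsto_L2:
  fixes \<phi> :: "real \<Rightarrow> real"
  assumes [measurable]: "\<phi> \<in> borel_measurable borel" "g \<in> borel_measurable borel"
    and L2: "(\<integral>\<^sup>+x. ennreal ((\<phi> x)\<^sup>2) \<partial>lborel) < \<infinity>"
    and lim: "AE \<omega> in lborel. (\<lambda>n. fourier_truncated n (\<lambda>x. complex_of_real (\<phi> x)) \<omega>) \<longlonglongrightarrow> g \<omega>"
  shows "(\<integral>\<^sup>+\<omega>. ennreal ((cmod (fourier_truncated n (\<lambda>x. complex_of_real (\<phi> x)) \<omega> - g \<omega>))\<^sup>2) \<partial>lborel)
    \<le> (\<integral>\<^sup>+x. ennreal ((indicator (- {- real n..real n}) x * \<phi> x)\<^sup>2) \<partial>lborel)"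
proof (rule nn_integral_le_of_tendsto)
  let ?t = "\<lambda>n. fourier_truncated n (\<lambda>x. complex_of_real (\<phi> x))"
  show "(\<lambda>\<omega>. ennreal ((cmod (?t n \<omega> - ?t m \<omega>))\<^sup>2)) \<in> borel_measurable lborel" for m
    by measurable
  show "AE \<omega> in lborel. (\<lambda>m. ennreal ((cmod (?t n \<omega> - ?t m \<omega>))\<^sup>2)) \<longlonglongrightarrow> ennreal ((cmod (?t n \<omega> - g \<omega>))\<^sup>2)"
    using lim by eventually_elim (intro tendsto_intros tendsto_ennrealI)
  show "eventually (\<lambda>m. (\<integral>\<^sup>+\<omega>. ennreal ((cmod (?t n \<omega> - ?t m \<omega>))\<^sup>2) \<partial>lborel) \<le>
     (\<integral>\<^sup>+x. ennreal ((indicator (- {- real n..real n}) x * \<phi> x)\<^sup>2) \<partial>lborel)) sequentially"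
    using eventually_ge_at_top[of n] by eventually_elim (rule fourier_truncated_diff_le[OF assms(1) L2])
qed

lemma tail_L2_tendsto_zero:
  fixes \<phi> :: "real \<Rightarrow> real"
  assumes [measurable]: "\<phi> \<in> borel_measurable borel"
    and L2: "(\<integral>\<^sup>+x. ennreal ((\<phi> x)\<^sup>2) \<partial>lborel) < \<infinity>"
  shows "(\<lambda>n. \<integral>\<^sup>+x. ennreal ((indicator (- {- real n..real n}) x * \<phi> x)\<^sup>2) \<partial>lborel) \<longlonglongrightarrow> 0"
proof -
  have "(\<lambda>n. \<integral>\<^sup>+x. ennreal ((indicator (- {- real n..real n}) x * \<phi> x)\<^sup>2) \<partial>lborel) \<longlonglongrightarrow> (\<integral>\<^sup>+(x::real). 0 \<partial>lborel)"
  proof (rule nn_integral_dominated_convergence[where w = "\<lambda>x. ennreal ((\<phi> x)\<^sup>2)"])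
    show "AE x in lborel. (\<lambda>n. ennreal ((indicator (- {- real n..real n}) x * \<phi> x)\<^sup>2)) \<longlonglongrightarrow> 0"
    proof (rule AE_I2)
      fix x :: real
      have "eventually (\<lambda>n. ennreal ((indicator (- {- real n..real n}) x * \<phi> x)\<^sup>2) = 0) sequentially"
        using eventually_ge_at_top[of "nat \<lceil>\<bar>x\<bar>\<rceil>"] by eventually_elim (auto simp: indicator_def)
      then show "(\<lambda>n. ennreal ((indicator (- {- real n..real n}) x * \<phi> x)\<^sup>2)) \<longlonglongrightarrow> 0"
        by (rule tendsto_eventually)
    qed
  qed (use L2 in \<open>auto simp: indicator_def\<close>)
  then show ?thesis by simp
qed

text \<open>The tail bound makes \<open>g\<close> an L2 limit of the truncated transforms. Limits in
  L2 are unique up to null sets, so the versions of the transform are exactly the class of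
  \<open>g\<close>.\<close>

lemma fourier_L2_eq_ae_class:
  fixes \<phi> :: "real \<Rightarrow> real"
  assumes [measurable]: "\<phi> \<in> borel_measurable borel" "g \<in> borel_measurable borel"
    and L2: "(\<integral>\<^sup>+x. ennreal ((\<phi> x)\<^sup>2) \<partial>lborel) < \<infinity>"
    and lim: "AE \<omega> in lborel. (\<lambda>n. fourier_truncated n (\<lambda>x. complex_of_real (\<phi> x)) \<omega>) \<longlonglongrightarrow> g \<omega>"
  shows "fourier_L2 (\<lambda>x. complex_of_real (\<phi> x)) = ae_class g"
    and "(\<integral>\<^sup>+\<omega>. ennreal ((cmod (g \<omega>))\<^sup>2) \<partial>lborel) < \<infinity>"
proof -
  let ?t = "\<lambda>n. fourier_truncated n (\<lambda>x. complex_of_real (\<phi> x))"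
  note le = fourier_truncated_tendsto_L2[OF assms]
  have conv: "(\<lambda>n. \<integral>\<^sup>+\<omega>. ennreal ((cmod (?t n \<omega> - g \<omega>))\<^sup>2) \<partial>lborel) \<longlonglongrightarrow> 0"
    by (rule tendsto_sandwich[OF _ _ tendsto_const tail_L2_tendsto_zero[OF assms(1) L2]])
      (auto intro: always_eventually le)
  \<comment> \<open>Truncation to [-0, 0] leaves a single point, a null set. The tail bound at n = 0
    therefore bounds the L2 norm of \<open>g\<close> itself.\<close>
  have "?t 0 \<omega> = 0" for \<omega>
  proof -
    have "AE x::real in lborel. x \<noteq> 0"
      by (rule AE_lborel_singleton)
    then have "(\<integral>x. (indicator {- real 0..real 0} x * \<phi> x) *\<^sub>R iexp (- (\<omega> * x)) \<partial>lborel) = 0"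
      by (intro integral_eq_zero_AE, elim eventually_mono) (auto simp: indicator_def)
    then show ?thesis unfolding fourier_truncated_of_real by simp
  qed
  then have "(\<integral>\<^sup>+\<omega>. ennreal ((cmod (g \<omega>))\<^sup>2) \<partial>lborel) \<le> (\<integral>\<^sup>+x. ennreal ((indicator (- {- real 0..real 0}) x * \<phi> x)\<^sup>2) \<partial>lborel)"
    using le[of 0] by simp
  also have "\<dots> \<le> (\<integral>\<^sup>+x. ennreal ((\<phi> x)\<^sup>2) \<partial>lborel)"
    by (intro nn_integral_mono ennreal_leI) (auto simp: indicator_def)
  also note L2
  finally show fin: "(\<integral>\<^sup>+\<omega>. ennreal ((cmod (g \<omega>))\<^sup>2) \<partial>lborel) < \<infinity>" .
  show "fourier_L2 (\<lambda>x. complex_of_real (\<phi> x)) = ae_class g"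
  proof (intro equalityI subsetI)
    fix h assume "h \<in> ae_class g"
    then have [measurable]: "h \<in> borel_measurable borel" and ae: "AE \<omega> in lborel. h \<omega> = g \<omega>"
      by (auto simp: ae_class_def)
    have "(\<integral>\<^sup>+\<omega>. ennreal ((cmod (h \<omega>))\<^sup>2) \<partial>lborel) = (\<integral>\<^sup>+\<omega>. ennreal ((cmod (g \<omega>))\<^sup>2) \<partial>lborel)"
      using ae by (intro nn_integral_cong_AE) (auto elim!: eventually_mono)
    moreover have "(\<integral>\<^sup>+\<omega>. ennreal ((cmod (?t n \<omega> - h \<omega>))\<^sup>2) \<partial>lborel) = (\<integral>\<^sup>+\<omega>. ennreal ((cmod (?t n \<omega> - g \<omega>))\<^sup>2) \<partial>lborel)" for n
      using ae by (intro nn_integral_cong_AE) (auto elim!: eventually_mono)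
    ultimately show "h \<in> fourier_L2 (\<lambda>x. complex_of_real (\<phi> x))"
      using conv fin by (simp add: fourier_L2_def)
  next
    fix h assume "h \<in> fourier_L2 (\<lambda>x. complex_of_real (\<phi> x))"
    then have [measurable]: "h \<in> borel_measurable borel"
      and conv': "(\<lambda>n. \<integral>\<^sup>+\<omega>. ennreal ((cmod (?t n \<omega> - h \<omega>))\<^sup>2) \<partial>lborel) \<longlonglongrightarrow> 0"
      by (auto simp: fourier_L2_def)
    \<comment> \<open>The squared distance between \<open>g\<close> and \<open>h\<close> is
      independent of n but bounded by two sequences that tend to 0.\<close>
    let ?D = "\<integral>\<^sup>+\<omega>. ennreal ((cmod (g \<omega> - h \<omega>))\<^sup>2) \<partial>lborel"
    have "?D \<le> 2 * (\<integral>\<^sup>+\<omega>. ennreal ((cmod (?t n \<omega> - h \<omega>))\<^sup>2) \<partial>lborel) + 2 * (\<integral>\<^sup>+\<omega>. ennreal ((cmod (?t n \<omega> - g \<omega>))\<^sup>2) \<partial>lborel)" for n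
      using nn_integral_norm_add_sq_le[of "\<lambda>\<omega>. ?t n \<omega> - h \<omega>" lborel "\<lambda>\<omega>. g \<omega> - ?t n \<omega>"]
      by (simp add: norm_minus_commute)
    moreover have "(\<lambda>n. 2 * (\<integral>\<^sup>+\<omega>. ennreal ((cmod (?t n \<omega> - h \<omega>))\<^sup>2) \<partial>lborel) + 2 * (\<integral>\<^sup>+\<omega>. ennreal ((cmod (?t n \<omega> - g \<omega>))\<^sup>2) \<partial>lborel)) \<longlonglongrightarrow> 2 * 0 + 2 * 0"
      by (intro tendsto_add ennreal_tendsto_cmult conv conv') auto
    ultimately have "?D \<le> 2 * 0 + 2 * 0"
      by (intro LIMSEQ_le_const) auto
    then have "?D = 0" by simp
    then have "AE \<omega> in lborel. ennreal ((cmod (g \<omega> - h \<omega>))\<^sup>2) = 0"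
      by (subst (asm) nn_integral_0_iff_AE) auto
    then have "AE \<omega> in lborel. h \<omega> = g \<omega>"
      by (auto elim!: eventually_mono)
    then show "h \<in> ae_class g" by (simp add: ae_class_def)
  qed
qed

subsection \<open>Spectral transport of distribution functions\<close>

text \<open>The projection onto [-b, b]. It appears because cutting the step at y down to [-b, b]
  leaves the interval from \<open>clip b y\<close> to b, up to the point b.\<close>

definition clip :: "real \<Rightarrow> real \<Rightarrow> real" where
  "clip b y = max (- b) (min b y)"

lemma borel_measurable_clip [measurable]: "clip b \<in> borel_measurable borel"
  unfolding clip_def[abs_def] by measurable

lemma integral_iexp_Icc:
  assumes "a \<le> b" "\<omega> \<noteq> 0"
  shows "(\<integral>x. indicator {a..b} x *\<^sub>R iexp (- (\<omega> * x)) \<partial>lborel) = \<i> * (iexp (- (\<omega> * b)) - iexp (- (\<omega> * a))) / \<omega>"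
proof -
  have "(\<integral>x. indicator {a..b} x *\<^sub>R iexp (- (\<omega> * x)) \<partial>lborel) =
      \<i> * iexp (- (\<omega> * b)) / \<omega> - \<i> * iexp (- (\<omega> * a)) / \<omega>"
  proof (rule integral_FTC_Icc[OF assms(1), where F = "\<lambda>x. \<i> * iexp (- (\<omega> * x)) / complex_of_real \<omega>"])
    fix x
    show "((\<lambda>x. \<i> * iexp (- (\<omega> * x)) / complex_of_real \<omega>) has_vector_derivative iexp (- (\<omega> * x))) (at x within {a..b})"
      using assms(2)
      by (auto intro!: derivative_eq_intros has_vector_derivative_real_field simp: field_simps)
  qed (intro continuous_intros)
  then show ?thesis by (simp add: right_diff_distrib diff_divide_distrib)
qed

text \<open>Both truncated steps are intervals ending at b, with left ends \<open>clip b y\<close>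
  and 0, so the contributions of b cancel.\<close>

lemma integral_step_iexp:
  assumes "\<omega> \<noteq> 0" "0 \<le> b"
  shows "(\<integral>x. (indicator {-b..b} x * (indicator {..x} y - indicator {0..} x)) *\<^sub>R iexp (- (\<omega> * x)) \<partial>lborel) =
    \<i> * (1 - iexp (- (\<omega> * clip b y))) / \<omega>"
proof -
  have int: "integrable lborel (\<lambda>x. indicator {clip b y..b} x *\<^sub>R iexp (- (\<omega> * x)))" for y
    by (rule borel_integrable_compact) (auto intro!: continuous_intros)
  have c0: "clip b 0 = 0" using assms by (simp add: clip_def)
  have "(\<integral>x. (indicator {-b..b} x * (indicator {..x} y - indicator {0..} x)) *\<^sub>R iexp (- (\<omega> * x)) \<partial>lborel) =
     (\<integral>x. indicator {clip b y..b} x *\<^sub>R iexp (- (\<omega> * x)) - indicator {clip b 0..b} x *\<^sub>R iexp (- (\<omega> * x)) \<partial>lborel)"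
    \<comment> \<open>For y > b the truncated step is empty while {\<open>clip b y\<close>..b} is
      the singleton {b}, so x = b has to be excluded.\<close>
    using AE_lborel_singleton[of b]
    by (intro integral_cong_AE) (auto elim!: eventually_mono simp: indicator_def clip_def)
  also have "\<dots> = \<i> * (iexp (- (\<omega> * b)) - iexp (- (\<omega> * clip b y))) / \<omega> - \<i> * (iexp (- (\<omega> * b)) - iexp (- (\<omega> * clip b 0))) / \<omega>"
    using assms by (subst Bochner_Integration.integral_diff[OF int int], subst (1 2) integral_iexp_Icc) (auto simp: clip_def)
  also have "\<dots> = \<i> * (1 - iexp (- (\<omega> * clip b y))) / \<omega>"
    unfolding c0 by (simp add: diff_divide_distrib[symmetric] right_diff_distrib[symmetric])
  finally show ?thesis .
qed

context real_distribution
begin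

text \<open>Formally this is the transform of the measure \<open>M\<close> minus a unit mass at 0,
  divided by i \<omega>. The conjugate reconciles the sign of the exponent in the transform with
  that in \<open>char\<close>. The value at \<omega> = 0 is 0 by division by zero and concerns only
  a null set.\<close>

definition fourier_centre_cdf :: "real \<Rightarrow> complex" where
  "fourier_centre_cdf \<omega> = \<i> * (1 - cnj (char M \<omega>)) / (\<omega> * sqrt (2 * pi))"

lemma borel_measurable_fourier_centre_cdf [measurable]: "fourier_centre_cdf \<in> borel_measurable borel"
proof -
  have "(\<lambda>\<omega>. cnj (char M \<omega>)) \<in> borel_measurable borel"
    by (intro borel_measurable_continuous_onI continuous_at_imp_continuous_on ballI continuous_intros isCont_char)
  then show ?thesis unfolding fourier_centre_cdf_def[abs_def] by measurable
qed

text \<open>The centred CDF at x is the mean over y of the step at y minus the step at 0. Truncation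
  makes the integrand bounded on a set of finite measure, so Fubini applies and each y contributes
  an explicit integral.\<close>

lemma fourier_truncated_centre_cdf:
  assumes "\<omega> \<noteq> 0"
  shows "fourier_truncated n (\<lambda>x. complex_of_real (centre (cdf M) x)) \<omega> =
    \<i> * (1 - (\<integral>y. iexp (- (\<omega> * clip n y)) \<partial>M)) / (\<omega> * sqrt (2 * pi))"
proof -
  interpret pair_sigma_finite M lborel by standard
  let ?f = "\<lambda>y x. (indicator {- real n..real n} x * (indicator {..x} y - indicator {0..} x)) *\<^sub>R iexp (- (\<omega> * x))"
  have [measurable]: "(\<lambda>p. indicator {..snd p} (fst p) :: real) \<in> borel_measurable (M \<Otimes>\<^sub>M lborel)"
  proof -
    have "(\<lambda>p. if fst p \<le> snd p then 1 else 0 :: real) \<in> borel_measurable (M \<Otimes>\<^sub>M lborel)"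
      by measurable
    then show ?thesis by (simp add: indicator_def)
  qed
  have int: "integrable (M \<Otimes>\<^sub>M lborel) (\<lambda>(y, x). ?f y x)"
  proof (rule Bochner_Integration.integrable_bound[OF integrable_mult_pair[of "\<lambda>_. 1" "\<lambda>x. indicator {- real n..real n} x"]])
    show "(\<lambda>(y, x). ?f y x) \<in> borel_measurable (M \<Otimes>\<^sub>M lborel)"
      unfolding case_prod_beta' by measurable
    show "AE p in M \<Otimes>\<^sub>M lborel. norm (case p of (y, x) \<Rightarrow> ?f y x) \<le> norm (case p of (y, x) \<Rightarrow> 1 * (indicator {- real n..real n} x :: real))"
      by (auto simp: indicator_def)
  qed auto
  have "(\<integral>y. ?f y x \<partial>M) = (indicator {- real n..real n} x * centre (cdf M) x) *\<^sub>R iexp (- (\<omega> * x))" for x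
  proof -
    have i: "integrable M (\<lambda>y. indicator {..x} y :: real)"
      by (simp add: integrable_real_indicator less_top[symmetric])
    then have "(\<integral>y. indicator {- real n..real n} x * (indicator {..x} y - indicator {0..} x) \<partial>M) =
        indicator {- real n..real n} x * centre (cdf M) x"
      by (simp add: centre_def cdf_def prob_space del: space_eq_univ)
    then show ?thesis
      using i by (subst integral_scaleR_left) auto
  qed
  then have "fourier_truncated n (\<lambda>x. complex_of_real (centre (cdf M) x)) \<omega> =
     (1 / sqrt (2 * pi)) *\<^sub>R (\<integral>x. \<integral>y. ?f y x \<partial>M \<partial>lborel)"
    by (simp add: fourier_truncated_of_real)
  also have "(\<integral>x. \<integral>y. ?f y x \<partial>M \<partial>lborel) = (\<integral>y. \<integral>x. ?f y x \<partial>lborel \<partial>M)"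
    by (rule Fubini_integral[OF int])
  also have "\<dots> = (\<integral>y. \<i> * (1 - iexp (- (\<omega> * clip n y))) / \<omega> \<partial>M)"
    using assms by (subst integral_step_iexp) auto
  also have "\<dots> = \<i> * (1 - (\<integral>y. iexp (- (\<omega> * clip n y)) \<partial>M)) / \<omega>"
  proof -
    have "integrable M (\<lambda>y. iexp (- (\<omega> * clip n y)))"
      by (rule integrable_iexp) auto
    then show ?thesis by (simp add: prob_space del: space_eq_univ)
  qed
  finally show ?thesis by (simp add: scaleR_conv_of_real)
qed

text \<open>Each y is left fixed by \<open>clip n\<close> once n is at least |y|, and the
  exponentials have modulus 1, so dominated convergence applies.\<close>

lemma fourier_truncated_centre_cdf_tendsto:
  assumes "\<omega> \<noteq> 0"
  shows "(\<lambda>n. fourier_truncated n (\<lambda>x. complex_of_real (centre (cdf M) x)) \<omega>) \<longlonglongrightarrow> fourier_centre_cdf \<omega>"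
proof -
  have "(\<lambda>n. \<integral>y. iexp (- (\<omega> * clip n y)) \<partial>M) \<longlonglongrightarrow> (\<integral>y. iexp (- (\<omega> * y)) \<partial>M)"
  proof (rule integral_dominated_convergence[where w = "\<lambda>_. 1"])
    show "AE y in M. (\<lambda>n. iexp (- (\<omega> * clip n y))) \<longlonglongrightarrow> iexp (- (\<omega> * y))"
    proof (rule AE_I2)
      fix y
      have "eventually (\<lambda>n. iexp (- (\<omega> * clip (real n) y)) = iexp (- (\<omega> * y))) sequentially"
        using eventually_ge_at_top[of "nat \<lceil>\<bar>y\<bar>\<rceil>"] by eventually_elim (auto simp: clip_def min_def max_def)
      then show "(\<lambda>n. iexp (- (\<omega> * clip n y))) \<longlonglongrightarrow> iexp (- (\<omega> * y))"
        by (rule tendsto_eventually)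
    qed
  qed auto
  moreover have "(\<integral>y. iexp (- (\<omega> * y)) \<partial>M) = cnj (char M \<omega>)"
    unfolding char_def by (simp add: exp_cnj flip: Bochner_Integration.integral_cnj)
  ultimately show ?thesis
    unfolding fourier_truncated_centre_cdf[OF assms] fourier_centre_cdf_def
    using assms by (intro tendsto_intros) auto
qed

lemma borel_measurable_cdf [measurable]: "cdf M \<in> borel_measurable borel"
  by (rule borel_measurable_mono) (auto simp: mono_def cdf_nondecreasing)

lemma fourier_L2_centre_cdf:
  assumes "cramer_sq (cdf M) < \<infinity>"
  shows "fourier_L2 (\<lambda>x. complex_of_real (centre (cdf M) x)) = ae_class fourier_centre_cdf"
    and "(\<integral>\<^sup>+\<omega>. ennreal ((cmod (fourier_centre_cdf \<omega>))\<^sup>2) \<partial>lborel) < \<infinity>"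
proof -
  have [measurable]: "centre (cdf M) \<in> borel_measurable borel"
    unfolding centre_def[abs_def] by measurable
  have "AE \<omega> in lborel. (\<lambda>n. fourier_truncated n (\<lambda>x. complex_of_real (centre (cdf M) x)) \<omega>) \<longlonglongrightarrow> fourier_centre_cdf \<omega>"
    using AE_lborel_singleton[of 0] by eventually_elim (rule fourier_truncated_centre_cdf_tendsto)
  with assms show "fourier_L2 (\<lambda>x. complex_of_real (centre (cdf M) x)) = ae_class fourier_centre_cdf"
    and "(\<integral>\<^sup>+\<omega>. ennreal ((cmod (fourier_centre_cdf \<omega>))\<^sup>2) \<partial>lborel) < \<infinity>"
    by (intro fourier_L2_eq_ae_class; simp add: cramer_sq_def)+
qed

end

section \<open>Frequency classes and injectivity of the transport\<close>

lemma ae_class_cong: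
  assumes "AE \<omega> in lborel. g \<omega> = h \<omega>"
  shows "ae_class g = ae_class h"
  using assms by (auto simp: ae_class_def elim!: eventually_elim2)

lemma ae_class_eqD:
  assumes "ae_class g = ae_class h" "g \<in> borel_measurable borel"
  shows "AE \<omega> in lborel. g \<omega> = h \<omega>"
proof -
  have "g \<in> ae_class g" using assms(2) by (simp add: ae_class_def)
  then show ?thesis using assms(1) by (auto simp: ae_class_def)
qed

lemma U_op_ae_class:
  assumes [measurable]: "g \<in> borel_measurable borel"
    and L2: "(\<integral>\<^sup>+\<omega>. ennreal ((cmod (g \<omega>))\<^sup>2) \<partial>lborel) < \<infinity>" and "0 < \<epsilon>"
  shows "U_op \<epsilon> (ae_class g) = ae_class (\<lambda>\<omega>. - (complex_of_real (sqrt (2 * pi)) * \<i> * complex_of_real \<omega> * cnj (g \<omega>)))"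
    and "U_op \<epsilon> (ae_class g) \<in> H_eps \<epsilon>"
proof -
  let ?T = "\<lambda>h \<omega>. - (complex_of_real (sqrt (2 * pi)) * \<i> * complex_of_real \<omega> * cnj (h \<omega>))"
  \<comment> \<open>The weight of \<open>H_cdf\<close> is at most 1, so square-integrability is
    enough for membership.\<close>
  have fin: "(\<integral>\<^sup>+\<omega>. ennreal (\<omega>\<^sup>2 / (\<omega>\<^sup>2 + \<epsilon>) * (cmod (g \<omega>))\<^sup>2) \<partial>lborel) < \<infinity>"
  proof (rule le_less_trans[OF nn_integral_mono L2], rule ennreal_leI, rule mult_left_le_one_le)
    fix \<omega> :: real
    show "\<omega>\<^sup>2 / (\<omega>\<^sup>2 + \<epsilon>) \<le> 1" "0 \<le> \<omega>\<^sup>2 / (\<omega>\<^sup>2 + \<epsilon>)"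
      using \<open>0 < \<epsilon>\<close> by (auto simp: divide_simps add_nonneg_pos)
  qed simp
  then have "ae_class g \<in> H_cdf \<epsilon>"
    unfolding H_cdf_def by (intro CollectI exI[of _ g]) simp
  \<comment> \<open>Almost everywhere equal representatives have almost everywhere equal images, so
    the union in \<open>U_op\<close> collapses to one class.\<close>
  moreover have "(\<Union>h\<in>ae_class g. ae_class (?T h)) = ae_class (?T g)"
  proof -
    have "ae_class (?T h) = ae_class (?T g)" if "h \<in> ae_class g" for h
      using that by (intro ae_class_cong) (auto simp: ae_class_def elim!: eventually_mono)
    moreover have "g \<in> ae_class g" by (simp add: ae_class_def)
    ultimately show ?thesis by blast
  qed
  ultimately show eq: "U_op \<epsilon> (ae_class g) = ae_class (?T g)"
    by (simp add: U_op_def)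
  have Tg [measurable]: "?T g \<in> borel_measurable borel"
  proof -
    have [measurable]: "cnj \<in> borel_measurable borel"
      by (intro borel_measurable_continuous_onI continuous_intros)
    show ?thesis by measurable
  qed
  \<comment> \<open>The multiplier contributes 2 pi \<omega>^2, which turns the weight of
    \<open>H_eps\<close> into that of \<open>H_cdf\<close>; the factor 1/(2 pi) in
    \<open>H_eps\<close> makes \<open>U_op\<close> norm-preserving.\<close>
  have "(cmod (?T g \<omega>))\<^sup>2 / (\<omega>\<^sup>2 + \<epsilon>) = 2 * pi * (\<omega>\<^sup>2 / (\<omega>\<^sup>2 + \<epsilon>) * (cmod (g \<omega>))\<^sup>2)" for \<omega>
    by (simp add: norm_mult power_mult_distrib)
  then have "(\<integral>\<^sup>+ \<omega>. ennreal ((cmod (?T g \<omega>))\<^sup>2 / (\<omega>\<^sup>2 + \<epsilon>)) \<partial>lborel)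
     = ennreal (2 * pi) * (\<integral>\<^sup>+\<omega>. ennreal (\<omega>\<^sup>2 / (\<omega>\<^sup>2 + \<epsilon>) * (cmod (g \<omega>))\<^sup>2) \<partial>lborel)"
    by (simp add: ennreal_mult' nn_integral_cmult del: times_divide_eq_left)
  then have "ennreal (1 / (2 * pi)) * (\<integral>\<^sup>+ \<omega>. ennreal ((cmod (?T g \<omega>))\<^sup>2 / (\<omega>\<^sup>2 + \<epsilon>)) \<partial>lborel) < \<infinity>"
    using fin by (simp add: ennreal_mult_less_top)
  then show "U_op \<epsilon> (ae_class g) \<in> H_eps \<epsilon>"
    unfolding eq H_eps_def by (intro CollectI exI[of _ "?T g"] conjI refl Tg)
qed

text \<open>Away from \<omega> = 0 the multiplier of \<open>U_op\<close> cancels the denominator of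
  \<open>fourier_centre_cdf\<close>, and its conjugation turns the conjugate of
  \<open>char M\<close> back into \<open>char M\<close>.\<close>

lemma V_op_cdf:
  assumes M: "real_distribution M" and fin: "cramer_sq (cdf M) < \<infinity>" and "0 < \<epsilon>"
  shows "V_op \<epsilon> (cdf M) = ae_class (\<lambda>\<omega>. char M \<omega> - 1)"
    and "V_op \<epsilon> (cdf M) \<in> H_eps \<epsilon>"
proof -
  interpret real_distribution M by (rule M)
  have "cdf M \<in> Gamma_F" using M fin by (auto simp: Gamma_F_def)
  then have V: "V_op \<epsilon> (cdf M) = U_op \<epsilon> (ae_class fourier_centre_cdf)"
    by (simp add: V_op_def fourier_L2_centre_cdf[OF fin])
  note U = U_op_ae_class[OF _ fourier_L2_centre_cdf(2)[OF fin] \<open>0 < \<epsilon>\<close>]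
  show "V_op \<epsilon> (cdf M) \<in> H_eps \<epsilon>"
    unfolding V by (rule U) simp
  have "- (complex_of_real (sqrt (2 * pi)) * \<i> * complex_of_real \<omega> * cnj (fourier_centre_cdf \<omega>)) = char M \<omega> - 1"
    if "\<omega> \<noteq> 0" for \<omega>
    using that by (simp add: fourier_centre_cdf_def field_simps)
  then show "V_op \<epsilon> (cdf M) = ae_class (\<lambda>\<omega>. char M \<omega> - 1)"
    unfolding V U(1)[OF borel_measurable_fourier_centre_cdf]
    using AE_lborel_singleton[of 0] by (intro ae_class_cong) (auto elim!: eventually_mono)
qed

text \<open>The set of disagreement is open and null, and a nonempty open set of reals is not
  negligible.\<close>

lemma AE_lborel_eq_imp_eq:
  fixes f g :: "real \<Rightarrow> 'a::t2_space"
  assumes cont: "continuous_on UNIV f" "continuous_on UNIV g"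
    and ae: "AE x in lborel. f x = g x"
  shows "f = g"
proof -
  have op: "open {x. f x \<noteq> g x}"
    using cont by (rule open_Collect_neq)
  moreover have "{x. f x \<noteq> g x} \<in> null_sets lborel"
    using ae op AE_iff_null[of lborel "\<lambda>x. f x = g x"] by simp
  then have "negligible {x. f x \<noteq> g x}"
    by (simp add: negligible_iff_null_sets null_sets_completionI)
  ultimately have "{x. f x \<noteq> g x} = {}"
    using open_not_negligible by blast
  then show ?thesis by auto
qed

text \<open>Equal classes give equality of characteristic functions only almost everywhere; their
  continuity upgrades it to every frequency, as uniqueness requires.\<close>

lemma inj_on_V_op:
  assumes "0 < \<epsilon>"
  shows "inj_on (V_op \<epsilon>) Gamma_F"
proof (rule inj_onI)
  fix F G assume "F \<in> Gamma_F" "G \<in> Gamma_F" and eq: "V_op \<epsilon> F = V_op \<epsilon> G"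
  then obtain M N where M: "real_distribution M" "F = cdf M" "cramer_sq (cdf M) < \<infinity>"
    and N: "real_distribution N" "G = cdf N" "cramer_sq (cdf N) < \<infinity>"
    by (auto simp: Gamma_F_def)
  have cont: "continuous_on UNIV (char M)" "continuous_on UNIV (char N)"
    using M(1) N(1) by (auto intro: continuous_at_imp_continuous_on real_distribution.isCont_char)
  have "AE \<omega> in lborel. char M \<omega> - 1 = char N \<omega> - 1"
    using eq M N V_op_cdf(1)[OF _ _ assms] real_distribution.char_measurable[OF M(1)]
    by (intro ae_class_eqD) auto
  then have "char M = char N"
    by (intro AE_lborel_eq_imp_eq cont) simp
  then show "F = G"
    using Levy_uniqueness[OF M(1) N(1)] M N by simp
qed

subsection \<open>Mixtures of distribution functions\<close>

text \<open>Replace x by a grid point to its right. The approximant takes countably many grid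
  points, each giving a function measurable in p, and right continuity yields pointwise
  convergence.\<close>

lemma borel_measurable_pair_right_continuous:
  fixes F :: "'a \<Rightarrow> real \<Rightarrow> real"
  assumes meas: "\<And>x. (\<lambda>p. F p x) \<in> borel_measurable M"
    and cont: "\<And>p x. p \<in> space M \<Longrightarrow> continuous (at_right x) (F p)"
  shows "(\<lambda>(p, x). F p x) \<in> borel_measurable (M \<Otimes>\<^sub>M borel)"
proof (rule borel_measurable_LIMSEQ_real)
  \<comment> \<open>\<open>?r n (?k n x)\<close> is the least multiple of 1/(n+1) strictly above x;
    the added 1 keeps it off x, as \<open>at_right\<close> demands.\<close>
  let ?r = "\<lambda>(n::nat) (k::int). (of_int k + 1) / real (Suc n)"
  let ?k = "\<lambda>(n::nat) (x::real). \<lfloor>x * real (Suc n)\<rfloor>"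
  show "(\<lambda>px. F (fst px) (?r n (?k n (snd px)))) \<in> borel_measurable (M \<Otimes>\<^sub>M borel)" for n
  proof (rule measurable_compose_countable[where f = "\<lambda>k px. F (fst px) (?r n k)"])
    show "(\<lambda>px. F (fst px) (?r n k)) \<in> borel_measurable (M \<Otimes>\<^sub>M borel)" for k
      by (rule measurable_compose[OF measurable_fst meas])
  qed measurable
  fix px :: "'a \<times> real" assume "px \<in> space (M \<Otimes>\<^sub>M borel)"
  then obtain p x where px: "px = (p, x)" and p: "p \<in> space M"
    by (auto simp: space_pair_measure)
  have gt: "x < ?r n (?k n x)" for n
    by (simp add: pos_less_divide_eq)
  have "(\<lambda>n. ?r n (?k n x)) \<longlonglongrightarrow> x"
  proof (rule tendsto_sandwich)
    show "eventually (\<lambda>n. x \<le> ?r n (?k n x)) sequentially"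
      using gt by (intro always_eventually allI less_imp_le)
    show "eventually (\<lambda>n. ?r n (?k n x) \<le> x + 1 / real (Suc n)) sequentially"
    proof (intro always_eventually allI)
      fix n
      have "?r n (?k n x) \<le> (x * real (Suc n) + 1) / real (Suc n)"
        by (intro divide_right_mono add_right_mono of_int_floor_le) simp
      also have "\<dots> = x + 1 / real (Suc n)"
        by (subst add_divide_distrib) simp
      finally show "?r n (?k n x) \<le> x + 1 / real (Suc n)" .
    qed
    show "(\<lambda>n. x + 1 / real (Suc n)) \<longlonglongrightarrow> x"
      using tendsto_add[OF tendsto_const LIMSEQ_Suc[OF lim_1_over_n], of x] by simp
  qed simp
  then have "filterlim (\<lambda>n. ?r n (?k n x)) (at_right x) sequentially"
    using gt by (auto simp: filterlim_at intro!: always_eventually less_imp_neq[symmetric])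
  then show "(\<lambda>n. F (fst px) (?r n (?k n (snd px)))) \<longlonglongrightarrow> (case px of (p, x) \<Rightarrow> F p x)"
    using cont[OF p, of x] unfolding px continuous_within by (auto intro: filterlim_compose)
qed

text \<open>Jensen's inequality for the square, read off from the nonnegativity of the
  variance.\<close>

lemma (in prob_space) nn_integral_square_expectation_le:
  fixes f :: "'a \<Rightarrow> real"
  assumes [measurable]: "f \<in> borel_measurable M" and bdd: "\<And>x. x \<in> space M \<Longrightarrow> \<bar>f x\<bar> \<le> B"
  shows "ennreal ((expectation f)\<^sup>2) \<le> (\<integral>\<^sup>+x. ennreal ((f x)\<^sup>2) \<partial>M)"
proof -
  have f: "integrable M f"
    by (rule integrable_const_bound[of _ B]) (auto simp: bdd)
  have f2: "integrable M (\<lambda>x. (f x)\<^sup>2)"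
    by (rule integrable_const_bound[of _ "B\<^sup>2"]) (auto simp: bdd abs_le_square_iff[symmetric] intro!: AE_I2 order_trans[OF bdd])
  have "(expectation f)\<^sup>2 \<le> expectation (\<lambda>x. (f x)\<^sup>2)"
    using variance_eq[OF f f2] variance_positive[of f] by simp
  then show ?thesis
    by (subst nn_integral_eq_integral[OF f2]) (auto intro: ennreal_leI)
qed

section \<open>Affine images and mixtures of CDFs\<close>

lemma Gamma_F_D:
  assumes "F \<in> Gamma_F"
  shows "mono F" "continuous (at_right x) F" "(F \<longlongrightarrow> 0) at_bot" "(F \<longlongrightarrow> 1) at_top"
    "0 \<le> F x" "F x \<le> 1" "F \<in> borel_measurable borel"
proof -
  obtain M where "real_distribution M" and F: "F = cdf M"
    using assms by (auto simp: Gamma_F_def)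
  then interpret real_distribution M by simp
  show "mono F" "continuous (at_right x) F" "(F \<longlongrightarrow> 0) at_bot" "(F \<longlongrightarrow> 1) at_top"
    "0 \<le> F x" "F x \<le> 1" "F \<in> borel_measurable borel"
    unfolding F using cdf_lim_at_bot cdf_lim_at_top_prob
    by (auto simp: mono_def cdf_nondecreasing cdf_is_right_cont cdf_nonneg cdf_bounded_prob)
qed

lemma cramer_sq_affine_le:
  fixes c \<gamma> :: real
  assumes F: "F \<in> Gamma_F" and "0 < \<gamma>"
  shows "cramer_sq (\<lambda>x. F ((x - c) / \<gamma>)) \<le> 2 * ennreal \<gamma> * cramer_sq F + 2 * ennreal \<bar>c\<bar>"
proof -
  have [measurable]: "F \<in> borel_measurable borel" by (rule Gamma_F_D[OF F])
  have [measurable]: "centre F \<in> borel_measurable borel"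
    unfolding centre_def[abs_def] by measurable
  let ?a = "\<lambda>x. centre F ((x - c) / \<gamma>)"
  let ?b = "\<lambda>x. indicator {c..} x - indicator {0..} x :: real"
  \<comment> \<open>Rescaling moves the step inside \<open>centre F\<close> from 0 to c. The
    correction \<open>?b\<close> is supported between 0 and c, which yields the term |c|; the
    substitution in \<open>?a\<close> yields the factor \<gamma>.\<close>
  have "centre (\<lambda>x. F ((x - c) / \<gamma>)) x = ?a x + ?b x" for x
    using \<open>0 < \<gamma>\<close> by (auto simp: centre_def indicator_def divide_simps)
  then have "cramer_sq (\<lambda>x. F ((x - c) / \<gamma>)) \<le>
      2 * (\<integral>\<^sup>+x. ennreal ((norm (?a x))\<^sup>2) \<partial>lborel) + 2 * (\<integral>\<^sup>+x. ennreal ((norm (?b x))\<^sup>2) \<partial>lborel)"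
    unfolding cramer_sq_def using nn_integral_norm_add_sq_le[of ?a lborel ?b] by simp
  also have "(\<integral>\<^sup>+x. ennreal ((norm (?a x))\<^sup>2) \<partial>lborel) = ennreal \<gamma> * cramer_sq F"
    using \<open>0 < \<gamma>\<close> nn_integral_real_affine[of "\<lambda>x. ennreal ((norm (?a x))\<^sup>2)" \<gamma> c]
    by (simp add: cramer_sq_def)
  also have "(\<integral>\<^sup>+x. ennreal ((norm (?b x))\<^sup>2) \<partial>lborel) \<le> (\<integral>\<^sup>+x. indicator {min c 0..max c 0} x \<partial>lborel)"
    by (intro nn_integral_mono) (auto simp: indicator_def)
  also have "\<dots> = ennreal \<bar>c\<bar>"
    by (simp add: min_def max_def)
  finally show ?thesis
    by (simp add: mult.assoc mult_left_mono add_left_mono)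
qed

text \<open>One Bellman backup at a fixed state-action pair, in abstract form: p stands for the next
  pair, \<open>M\<close> for its law, and \<open>c p\<close> for the reward minus \<gamma> \<alpha>
  times the log-density.\<close>

locale cdf_mixture = prob_space +
  fixes F :: "'a \<Rightarrow> real \<Rightarrow> real" and c :: "'a \<Rightarrow> real" and \<gamma> :: real
  assumes F: "\<And>p. p \<in> space M \<Longrightarrow> F p \<in> Gamma_F"
    and F_measurable: "\<And>x. (\<lambda>p. F p x) \<in> borel_measurable M"
    and c [measurable]: "c \<in> borel_measurable M"
    and \<gamma>: "0 < \<gamma>"
begin

definition mixture :: "real \<Rightarrow> real" where
  "mixture x = expectation (\<lambda>p. F p ((x - c p) / \<gamma>))"

text \<open>In the mixture the argument of \<open>F p\<close> itself varies with p through
  \<open>c p\<close>, so joint measurability is called for.\<close>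

lemma pair_measurable [measurable]:
  "(\<lambda>(p, x). F p x) \<in> borel_measurable (M \<Otimes>\<^sub>M borel)"
  by (rule borel_measurable_pair_right_continuous) (auto intro: F_measurable Gamma_F_D F)

lemma integrand_measurable [measurable]:
  "(\<lambda>p. F p ((x - c p) / \<gamma>)) \<in> borel_measurable M"
proof -
  have "(\<lambda>p. case (p, (x - c p) / \<gamma>) of (p, x) \<Rightarrow> F p x) \<in> borel_measurable M"
    by (rule measurable_compose[OF _ pair_measurable]) measurable
  then show ?thesis by simp
qed

lemma integrand_bounded: "p \<in> space M \<Longrightarrow> \<bar>F p x\<bar> \<le> 1"
  using Gamma_F_D(5,6)[OF F, of p x] by simp

lemma integrand_integrable: "integrable M (\<lambda>p. F p ((x - c p) / \<gamma>))"
  by (rule integrable_const_bound[of _ 1]) (auto simp: integrand_bounded)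

text \<open>Dominated convergence with bound 1, the common source of right continuity and of both
  limits at infinity.\<close>

lemma mixture_tendsto:
  assumes "\<And>p. p \<in> space M \<Longrightarrow> (\<lambda>n. F p ((u n - c p) / \<gamma>)) \<longlonglongrightarrow> v p" and "v \<in> borel_measurable M"
  shows "(\<lambda>n. mixture (u n)) \<longlonglongrightarrow> expectation v"
  unfolding mixture_def
  by (rule integral_dominated_convergence[where w = "\<lambda>_. 1"]) (use assms in \<open>auto simp: integrand_bounded\<close>)

lemma mono_mixture: "x \<le> y \<Longrightarrow> mixture x \<le> mixture y"
  unfolding mixture_def using \<gamma>
  by (intro integral_mono integrand_integrable monoD[OF Gamma_F_D(1)[OF F]] divide_right_mono) auto

lemma mixture_right_cont: "continuous (at_right a) mixture"
  unfolding continuous_within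
proof (rule tendsto_at_right_sequentially[where b = "a + 1"])
  fix u :: "nat \<Rightarrow> real" assume u: "\<And>n. a < u n" "u \<longlonglongrightarrow> a"
  show "(\<lambda>n. mixture (u n)) \<longlonglongrightarrow> mixture a"
    unfolding mixture_def[of a]
  proof (rule mixture_tendsto)
    fix p assume p: "p \<in> space M"
    have "(\<lambda>n. (u n - c p) / \<gamma>) \<longlonglongrightarrow> (a - c p) / \<gamma>"
      using \<gamma> u(2) by (intro tendsto_intros) auto
    \<comment> \<open>Since \<gamma> > 0, the arguments approach their limit strictly from the
      right, where \<open>F p\<close> is known to be continuous.\<close>
    then have "filterlim (\<lambda>n. (u n - c p) / \<gamma>) (at_right ((a - c p) / \<gamma>)) sequentially"
      using \<gamma> u(1) by (auto simp: filterlim_at divide_strict_right_mono less_imp_neq[symmetric])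
    then show "(\<lambda>n. F p ((u n - c p) / \<gamma>)) \<longlonglongrightarrow> F p ((a - c p) / \<gamma>)"
      using Gamma_F_D(2)[OF F[OF p], of "(a - c p) / \<gamma>"] unfolding continuous_within
      by (rule filterlim_compose[rotated])
  qed measurable
qed simp

lemma mixture_at_top: "(mixture \<longlongrightarrow> 1) at_top"
proof (rule tendsto_at_topI_sequentially_real)
  have "(\<lambda>n. mixture (real n)) \<longlonglongrightarrow> expectation (\<lambda>_. 1)"
  proof (rule mixture_tendsto)
    fix p assume p: "p \<in> space M"
    have "filterlim (\<lambda>n. (real n - c p) / \<gamma>) at_top sequentially"
      using \<gamma> by real_asymp
    then show "(\<lambda>n. F p ((real n - c p) / \<gamma>)) \<longlonglongrightarrow> 1"
      by (rule filterlim_compose[OF Gamma_F_D(4)[OF F[OF p]]])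
  qed simp
  then show "(\<lambda>n. mixture (real n)) \<longlonglongrightarrow> 1" by (simp add: prob_space)
qed (auto simp: mono_def mono_mixture)

lemma mixture_at_bot: "(mixture \<longlongrightarrow> 0) at_bot"
proof -
  \<comment> \<open>The sequential criterion concerns increasing functions at plus infinity, hence
    the reflection in both argument and value.\<close>
  have "((\<lambda>x. - mixture (- x)) \<longlongrightarrow> - 0) at_top"
  proof (rule tendsto_at_topI_sequentially_real)
    have "(\<lambda>n. mixture (- real n)) \<longlonglongrightarrow> expectation (\<lambda>_. 0)"
    proof (rule mixture_tendsto)
      fix p assume p: "p \<in> space M"
      have "filterlim (\<lambda>n. (- real n - c p) / \<gamma>) at_bot sequentially"
        using \<gamma> by real_asymp
      then show "(\<lambda>n. F p ((- real n - c p) / \<gamma>)) \<longlonglongrightarrow> 0"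
        by (rule filterlim_compose[OF Gamma_F_D(3)[OF F[OF p]]])
    qed simp
    then show "(\<lambda>n. - mixture (- real n)) \<longlonglongrightarrow> - 0"
      by (intro tendsto_minus) simp
  qed (auto simp: mono_def mono_mixture)
  from tendsto_minus[OF this] have "((\<lambda>x. mixture (- x)) \<longlongrightarrow> 0) at_top"
    by simp
  then show ?thesis by (subst filterlim_at_bot_mirror)
qed

lemma mixture_cdf: "real_distribution (interval_measure mixture)" "mixture = cdf (interval_measure mixture)"
proof -
  show "real_distribution (interval_measure mixture)"
    by (rule real_distribution_interval_measure[OF mono_mixture mixture_right_cont mixture_at_bot mixture_at_top])
  show "mixture = cdf (interval_measure mixture)"
    by (rule cdf_interval_measure[OF mono_mixture mixture_right_cont mixture_at_bot, symmetric])
qed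

lemma cramer_sq_mixture_le:
  assumes K: "\<And>p. p \<in> space M \<Longrightarrow> cramer_sq (F p) \<le> K"
  shows "cramer_sq mixture \<le> 2 * ennreal \<gamma> * K + 2 * (\<integral>\<^sup>+p. ennreal \<bar>c p\<bar> \<partial>M)"
proof -
  interpret pair_sigma_finite M lborel by standard
  let ?d = "\<lambda>p x. F p ((x - c p) / \<gamma>) - indicator {0..} x"
  have joint [measurable]: "(\<lambda>(p, x). ?d p x) \<in> borel_measurable (M \<Otimes>\<^sub>M borel)"
  proof -
    have "(\<lambda>q. case (fst q, (snd q - c (fst q)) / \<gamma>) of (p, x) \<Rightarrow> F p x) \<in> borel_measurable (M \<Otimes>\<^sub>M borel)"
      by (rule measurable_compose[OF _ pair_measurable]) measurable
    then show ?thesis by (simp add: case_prod_beta')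
  qed
  have d_bdd: "\<bar>?d p x\<bar> \<le> 1" if "p \<in> space M" for p x
    using Gamma_F_D(5,6)[OF F[OF that], of "(x - c p) / \<gamma>"] by (auto simp: indicator_def)
  \<comment> \<open>The step function does not depend on p and \<open>M\<close> has mass 1, so
    centring commutes with averaging; this prepares for Jensen.\<close>
  have "centre mixture x = expectation (\<lambda>p. ?d p x)" for x
    unfolding centre_def mixture_def by (simp add: integrand_integrable prob_space)
  then have "cramer_sq mixture = (\<integral>\<^sup>+x. ennreal ((expectation (\<lambda>p. ?d p x))\<^sup>2) \<partial>lborel)"
    by (simp add: cramer_sq_def)
  also have "\<dots> \<le> (\<integral>\<^sup>+x. \<integral>\<^sup>+p. ennreal ((?d p x)\<^sup>2) \<partial>M \<partial>lborel)"
    by (intro nn_integral_mono nn_integral_square_expectation_le[of _ 1]) (use d_bdd in auto)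
  also have "\<dots> = (\<integral>\<^sup>+p. \<integral>\<^sup>+x. ennreal ((?d p x)\<^sup>2) \<partial>lborel \<partial>M)"
    using joint by (intro Fubini') (auto simp: case_prod_beta')
  also have "\<dots> = (\<integral>\<^sup>+p. cramer_sq (\<lambda>x. F p ((x - c p) / \<gamma>)) \<partial>M)"
    by (simp add: cramer_sq_def centre_def)
  also have "\<dots> \<le> (\<integral>\<^sup>+p. 2 * ennreal \<gamma> * K + 2 * ennreal \<bar>c p\<bar> \<partial>M)"
    by (intro nn_integral_mono order_trans[OF cramer_sq_affine_le[OF F \<gamma>]] add_right_mono mult_left_mono K) auto
  also have "\<dots> = 2 * ennreal \<gamma> * K + 2 * (\<integral>\<^sup>+p. ennreal \<bar>c p\<bar> \<partial>M)"
    by (subst nn_integral_add) (auto simp: nn_integral_cmult emeasure_space_1)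
  finally show ?thesis .
qed

end

subsection \<open>The Bellman operator and its transport\<close>

lemma next_pair_in_prob_algebra:
  assumes P: "P \<in> S \<Otimes>\<^sub>M A \<rightarrow>\<^sub>M prob_algebra S" and \<pi>: "\<pi> \<in> S \<rightarrow>\<^sub>M prob_algebra A"
    and sa: "sa \<in> space (S \<Otimes>\<^sub>M A)"
  shows "next_pair S A P \<pi> sa \<in> space (prob_algebra (S \<Otimes>\<^sub>M A))"
proof -
  have "(\<lambda>s'. \<pi> s' \<bind> (\<lambda>a'. return (S \<Otimes>\<^sub>M A) (s', a'))) \<in> S \<rightarrow>\<^sub>M prob_algebra (S \<Otimes>\<^sub>M A)"
    by (rule measurable_bind_prob_space2[OF \<pi>])
      (use measurable_return_prob_space[of "S \<Otimes>\<^sub>M A"] in \<open>simp add: case_prod_beta'\<close>)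
  from measurable_bind_prob_space[OF P this] show ?thesis
    unfolding next_pair_def using sa by (rule measurable_space)
qed

text \<open>At each state-action pair the operator is an instance of \<open>cdf_mixture\<close>. The
  suprema \<open>K\<close> and \<open>B\<close> make the resulting bound the same at every pair, and
  measurability of the new field is the assumption \<open>meas\<close>.\<close>

lemma T_cdf_in_X_cdf:
  assumes mdp: "discounted_mdp S A P R \<gamma>" and pol: "stationary_policy S A \<mu> \<pi> \<rho>"
    and b: "(SUP (s, a)\<in>space (S \<Otimes>\<^sub>M A).
              \<integral>\<^sup>+ (s', a'). ennreal \<bar>R (s, a, s') - \<gamma> * \<alpha> * ln (\<rho> (s', a'))\<bar> \<partial>next_pair S A P \<pi> (s, a)) < \<infinity>"
    and meas: "\<And>x. (\<lambda>sa. bellman_expectation S A P R \<gamma> \<alpha> \<pi> \<rho> F sa x) \<in> borel_measurable (S \<Otimes>\<^sub>M A)"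
    and F: "F \<in> X_cdf S A"
  shows "T_cdf S A P R \<gamma> \<alpha> \<pi> \<rho> F \<in> X_cdf S A"
proof -
  have P: "P \<in> S \<Otimes>\<^sub>M A \<rightarrow>\<^sub>M prob_algebra S" and [measurable]: "R \<in> borel_measurable (S \<Otimes>\<^sub>M A \<Otimes>\<^sub>M S)"
    and \<gamma>: "0 < \<gamma>"
    using mdp by (auto simp: discounted_mdp_def)
  have \<pi>: "\<pi> \<in> S \<rightarrow>\<^sub>M prob_algebra A" and [measurable]: "\<rho> \<in> borel_measurable (S \<Otimes>\<^sub>M A)"
    using pol by (auto simp: stationary_policy_def)
  let ?X = "space (S \<Otimes>\<^sub>M A)"
  let ?T = "bellman_expectation S A P R \<gamma> \<alpha> \<pi> \<rho> F"
  define K where "K = (SUP sa\<in>?X. cramer_sq (F sa))"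
  define B where "B = (SUP (s, a)\<in>?X.
              \<integral>\<^sup>+ (s', a'). ennreal \<bar>R (s, a, s') - \<gamma> * \<alpha> * ln (\<rho> (s', a'))\<bar> \<partial>next_pair S A P \<pi> (s, a))"
  have K: "K < \<infinity>" using F by (simp add: X_cdf_def K_def)
  have B: "B < \<infinity>" using b by (simp add: B_def)
  have main: "(\<exists>M. real_distribution M \<and> ?T sa = cdf M) \<and> cramer_sq (?T sa) \<le> 2 * ennreal \<gamma> * K + 2 * B"
    if sa: "sa \<in> ?X" for sa
  proof -
    obtain s a where sa_eq: "sa = (s, a)" by fastforce
    have s: "s \<in> space S" "a \<in> space A" using sa by (auto simp: sa_eq space_pair_measure)
    let ?N = "next_pair S A P \<pi> sa"
    have N: "prob_space ?N" "sets ?N = sets (S \<Otimes>\<^sub>M A)"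
      using next_pair_in_prob_algebra[OF P \<pi> sa] by (auto simp: space_prob_algebra)
    note [measurable_cong] = N(2)
    have space_N: "space ?N = ?X" by (rule sets_eq_imp_space_eq[OF N(2)])
    let ?c = "\<lambda>p. R (s, a, fst p) - \<gamma> * \<alpha> * ln (\<rho> p)"
    interpret cdf_mixture ?N F ?c \<gamma>
    proof (intro cdf_mixture.intro cdf_mixture_axioms.intro N \<gamma>)
      show "F p \<in> Gamma_F" if "p \<in> space ?N" for p
        using that F by (auto simp: space_N X_cdf_def)
      show "(\<lambda>p. F p x) \<in> borel_measurable ?N" for x
        using F by (simp add: X_cdf_def measurable_cong_sets[OF N(2) refl])
      have "(\<lambda>p. R (s, a, fst p)) \<in> borel_measurable (S \<Otimes>\<^sub>M A)"
        using s by (intro measurable_compose[of "\<lambda>p. (s, a, fst p)", OF _ \<open>R \<in> _\<close>]) simp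
      then show "?c \<in> borel_measurable ?N"
        by measurable
    qed
    \<comment> \<open>The entropy term added after division by \<gamma> becomes part of the shift
      when multiplied by \<gamma>.\<close>
    have "F p ((x - R (s, a, fst p)) / \<gamma> + \<alpha> * ln (\<rho> p)) = F p ((x - ?c p) / \<gamma>)" for p x
    proof -
      have "(x - R (s, a, fst p)) / \<gamma> + \<alpha> * ln (\<rho> p) = (x - ?c p) / \<gamma>"
        using \<gamma> by (simp add: field_simps)
      then show ?thesis by simp
    qed
    then have T: "?T sa = mixture"
      unfolding mixture_def[abs_def] by (simp add: fun_eq_iff bellman_expectation_def sa_eq case_prod_beta')
    have "cramer_sq (F p) \<le> K" if "p \<in> space ?N" for p
      using that unfolding K_def space_N by (rule SUP_upper)
    then have "cramer_sq mixture \<le> 2 * ennreal \<gamma> * K + 2 * (\<integral>\<^sup>+p. ennreal \<bar>?c p\<bar> \<partial>?N)"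
      by (rule cramer_sq_mixture_le)
    also have "(\<integral>\<^sup>+p. ennreal \<bar>?c p\<bar> \<partial>?N) \<le> B"
      unfolding B_def using sa by (intro SUP_upper2[of sa]) (auto simp: sa_eq case_prod_beta')
    finally show ?thesis
      unfolding T using mixture_cdf by (auto simp: add_left_mono mult_left_mono)
  qed
  \<comment> \<open>One finite constant yields both membership of each value in
    \<open>Gamma_F\<close> and finiteness of the supremum.\<close>
  have fin: "2 * ennreal \<gamma> * K + 2 * B < \<infinity>"
    using K B by (simp add: ennreal_mult_less_top)
  have "(SUP sa\<in>?X. cramer_sq (?T sa)) \<le> 2 * ennreal \<gamma> * K + 2 * B"
    using main by (intro SUP_least) auto
  also note fin
  finally have "(SUP sa\<in>?X. cramer_sq (?T sa)) < \<infinity>" .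
  moreover have "?T sa \<in> Gamma_F" if "sa \<in> ?X" for sa
    using main[OF that] le_less_trans[OF conjunct2[OF main[OF that]] fin] by (auto simp: Gamma_F_def)
  moreover have "(\<lambda>sa. T_cdf S A P R \<gamma> \<alpha> \<pi> \<rho> F sa x) \<in> borel_measurable (S \<Otimes>\<^sub>M A)" for x
    using meas[of x] by (subst measurable_cong[where g = "\<lambda>sa. ?T sa x"]) (auto simp: T_cdf_def)
  ultimately show ?thesis
    by (auto simp: X_cdf_def T_cdf_def)
qed

section \<open>Transport of fields and the intertwining identity\<close>

lemma VV_in_H_eps:
  assumes "0 < \<epsilon>" "F \<in> X_cdf S A"
  shows "VV S A \<epsilon> F \<in> space (S \<Otimes>\<^sub>M A) \<rightarrow>\<^sub>E H_eps \<epsilon>"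
proof -
  have "V_op \<epsilon> G \<in> H_eps \<epsilon>" if "G \<in> Gamma_F" for G
    using that V_op_cdf(2)[OF _ _ assms(1)] by (auto simp: Gamma_F_def)
  then show ?thesis
    using assms(2) by (auto simp: VV_def X_cdf_def)
qed

lemma inj_on_VV:
  assumes "0 < \<epsilon>"
  shows "inj_on (VV S A \<epsilon>) (X_cdf S A)"
proof (rule inj_onI)
  fix F G assume FG: "F \<in> X_cdf S A" "G \<in> X_cdf S A" and eq: "VV S A \<epsilon> F = VV S A \<epsilon> G"
  have "F sa = G sa" if "sa \<in> space (S \<Otimes>\<^sub>M A)" for sa
    using FG that fun_cong[OF eq, of sa]
    by (intro inj_onD[OF inj_on_V_op[OF assms]]) (auto simp: VV_def X_cdf_def)
  \<comment> \<open>Outside the state-action space both fields are extensional and hence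
    agree.\<close>
  with FG show "F = G"
    by (auto simp: X_cdf_def intro: PiE_ext)
qed

theorem proposition13:
  fixes S :: "'s measure" and A :: "'a measure"
    and P :: "'s \<times> 'a \<Rightarrow> 's measure" and R :: "'s \<times> 'a \<times> 's \<Rightarrow> real"
    and \<mu> :: "'a measure" and \<pi> :: "'s \<Rightarrow> 'a measure" and \<rho> :: "'s \<times> 'a \<Rightarrow> real"
    and \<gamma> \<alpha> \<epsilon> :: real
  assumes "discounted_mdp S A P R \<gamma>"
    and "0 < \<alpha>" and "0 < \<epsilon>"
    and "stationary_policy S A \<mu> \<pi> \<rho>"
    and a: "\<forall>s\<in>space S. AE a in \<pi> s. 0 < \<rho> (s, a)"
    and b: "(SUP (s, a)\<in>space (S \<Otimes>\<^sub>M A).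
              \<integral>\<^sup>+ (s', a'). ennreal \<bar>R (s, a, s') - \<gamma> * \<alpha> * ln (\<rho> (s', a'))\<bar> \<partial>next_pair S A P \<pi> (s, a)) < \<infinity>"
    and c: "\<forall>F\<in>X_cdf S A. \<forall>x.
              (\<lambda>sa. bellman_expectation S A P R \<gamma> \<alpha> \<pi> \<rho> F sa x) \<in> borel_measurable (S \<Otimes>\<^sub>M A)"
  shows "\<forall>F\<in>X_cdf S A.
           T_cdf S A P R \<gamma> \<alpha> \<pi> \<rho> F \<in> X_cdf S A \<and>
           VV S A \<epsilon> F \<in> space (S \<Otimes>\<^sub>M A) \<rightarrow>\<^sub>E H_eps \<epsilon> \<and>
           VV S A \<epsilon> (T_cdf S A P R \<gamma> \<alpha> \<pi> \<rho> F) = T_spec S A P R \<gamma> \<alpha> \<pi> \<rho> \<epsilon> (VV S A \<epsilon> F)"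
proof (intro ballI conjI)
  fix F assume F: "F \<in> X_cdf S A"
  \<comment> \<open>\<open>VV\<close> is undefined outside \<open>X_cdf\<close>; this membership
    ensures that the identity below compares genuine transported fields.\<close>
  show "T_cdf S A P R \<gamma> \<alpha> \<pi> \<rho> F \<in> X_cdf S A"
    using assms F by (intro T_cdf_in_X_cdf) auto
  show "VV S A \<epsilon> F \<in> space (S \<Otimes>\<^sub>M A) \<rightarrow>\<^sub>E H_eps \<epsilon>"
    using \<open>0 < \<epsilon>\<close> F by (rule VV_in_H_eps)
  \<comment> \<open>By injectivity the preimage chosen by \<open>the_inv_into\<close> is
    \<open>F\<close> itself, so unfolding the conjugated operator gives the left-hand side.\<close>
  show "VV S A \<epsilon> (T_cdf S A P R \<gamma> \<alpha> \<pi> \<rho> F) = T_spec S A P R \<gamma> \<alpha> \<pi> \<rho> \<epsilon> (VV S A \<epsilon> F)"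
    using F by (simp add: T_spec_def X_adm_def the_inv_into_f_f[OF inj_on_VV[OF \<open>0 < \<epsilon>\<close>] F])
qed

end
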